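(* Let $\mathbf{f}$ be a simple problem and $\mathbf{g}\subseteq\mathbf{f}$ a subproblem. Then $$\partial X^*(\mathbf{g})=\bigsqcup_{\mathbf{h}\subsetneq\mathbf{g}}\operatorname{Int}X^*(\mathbf{h}),\qquad \partial\,\mathbf{f}X^*(\mathbf{g})=\bigsqcup_{\mathbf{h}\subsetneq\mathbf{g}}\operatorname{Int}\mathbf{f}X^*(\mathbf{h}),$$ where $\bigsqcup$ means the union is pairwise disjoint (the sets $\operatorname{Int}X^*(\mathbf{h})$ for distinct $\mathbf{h}$ are disjoint, and likewise for $\operatorname{Int}\mathbf{f}X^*(\mathbf{h})$).
   Context: A problem is a finite set $\mathbf{f}=\{f_1,\dots,f_m\}$ of functions $f_i:\mathbb{R}^n\to\mathbb{R}$ together with a feasible region $X\subseteq\mathbb{R}^n$, to be minimized simultaneously; its evaluation map is $x\mapsto(f_1(x),\dots,f_m(x))$. A subproblem $\mathbf{g}\subseteq\mathbf{f}$ is a subset of these functions (including $\emptyset$ and $\mathbf{f}$), with the same $X$; its evaluation map is $x\mapsto(f_i(x))_{f_i\in\mathbf{g}}\in\mathbb{R}^{|\mathbf{g}|}$. The Pareto set $X^*(\mathbf{g})$ is the set of $x^*\in X$ for which there is no $x\in X$ with $f_i(x)\le f_i(x^* )$ for all $f_i\in\mathbf{g}$ and $f_j(x)<f_j(x^* )$ for some $f_j\in\mathbf{g}$; by convention $X^*(\emptyset)=\emptyset$. $\mathbf{f}X^*(\mathbf{g})$ denotes the image of $X^*(\mathbf{g})$ under the evaluation map of $\mathbf{f}$.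 A problem $\mathbf{f}$ is simple if every subproblem $\mathbf{g}\subseteq\mathbf{f}$ with $k=|\mathbf{g}|$ objectives satisfies: (S1) $X^*(\mathbf{g})$ is homeomorphic to $\Delta^{k-1}=\{t\in[0,1]^k:\sum t_i=1\}$ (with $\Delta^{-1}=\emptyset$); (S2) the evaluation map of $\mathbf{g}$ restricted to $X^*(\mathbf{g})$ is a topological embedding into $\mathbb{R}^k$. For a simple problem, each $X^*(\mathbf{g})$ and $\mathbf{f}X^*(\mathbf{g})$ is homeomorphic to $\Delta^{|\mathbf{g}|-1}$, hence a topological manifold with boundary; $\operatorname{Int}$ and $\partial$ denote manifold interior and manifold boundary (for a single point the interior is the point and the boundary is empty; for $\emptyset$ both are empty). All sets carry the subspace topology from Euclidean space. *)

theory Defs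
  imports "HOL-Analysis.Analysis"
begin

text \<open>Objectives are functions on R^n (type real^'n); a (sub)problem is a set of them.
  The Euclidean space R^g indexed by a finite set g of objectives is represented as the
  functions (objective => real) vanishing outside g, with the product topology.\<close>

type_synonym 'n objective = "real^'n \<Rightarrow> real"

definition pareto_set :: "(real^'n) set \<Rightarrow> 'n objective set \<Rightarrow> (real^'n) set" where
  "pareto_set X g = (if g = {} then {} else
     {xs \<in> X. \<not> (\<exists>x\<in>X. (\<forall>f\<in>g. f x \<le> f xs) \<and> (\<exists>f\<in>g. f x < f xs))})"

definition eval_map :: "'n objective set \<Rightarrow> real^'n \<Rightarrow> ('n objective \<Rightarrow> real)" where
  "eval_map g x = (\<lambda>f. if f \<in> g then f x else 0)"

text \<open>Standard simplex in R^g, homeomorphic to Delta^{|g|-1} (empty when g is empty).\<close>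
definition std_simplex :: "'a set \<Rightarrow> ('a \<Rightarrow> real) set" where
  "std_simplex g = {t. (\<forall>i. i \<notin> g \<longrightarrow> t i = 0) \<and> (\<forall>i\<in>g. 0 \<le> t i \<and> t i \<le> 1) \<and> sum t g = 1}"

definition simple_problem :: "'n objective set \<Rightarrow> (real^'n) set \<Rightarrow> bool" where
  "simple_problem F X \<longleftrightarrow> finite F \<and> (\<forall>g. g \<subseteq> F \<longrightarrow>
      pareto_set X g homeomorphic std_simplex g \<and>
      embedding_map (top_of_set (pareto_set X g)) euclidean (eval_map g))"

definition Rsp :: "nat \<Rightarrow> (nat \<Rightarrow> real) set" where
  "Rsp d = {x. \<forall>i\<ge>d. x i = 0}"

definition mfd_interior :: "nat \<Rightarrow> 'a::topological_space set \<Rightarrow> 'a set" where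
  "mfd_interior d S = {p \<in> S. \<exists>U. openin (top_of_set S) U \<and> p \<in> U \<and>
      (\<exists>V. openin (top_of_set (Rsp d)) V \<and> U homeomorphic V)}"

definition mfd_boundary :: "nat \<Rightarrow> 'a::topological_space set \<Rightarrow> 'a set" where
  "mfd_boundary d S = S - mfd_interior d S"

end

theory Submission
  imports Defs "HOL-Homology.Invariance_of_Domain"
begin

text \<open>
  In a simple problem a point of \<open>X\<close> weakly dominating a Pareto point of \<open>g\<close> equals it. Hence
  \<open>X*(h) \<subseteq> X*(g)\<close> for \<open>h \<subseteq> g\<close>, and on \<open>X*(g)\<close> the differences of the objectives are injective, so by
  invariance of domain they are open near a manifold interior point; moving in a direction that
  favours \<open>h\<close> shows that \<open>X*(h)\<close> misses \<open>Int X*(g)\<close> for \<open>h \<subset> g\<close>.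

  By induction on \<open>g\<close> one proves that the sets \<open>X*(h)\<close>, \<open>h \<subset> g\<close>, cover \<open>\<partial>X*(g)\<close> and that
  \<open>X*(h) \<inter> X*(h') = X*(h \<inter> h')\<close>. The induction hypothesis yields a map of the boundary of the simplex
  into \<open>\<partial>X*(g)\<close> that takes each face \<open>h\<close> homeomorphically onto \<open>X*(h)\<close>. If it missed a boundary
  point \<open>x\<close>, so would its cone extension to the simplex, and the KKM lemma would produce a point
  dominating \<open>x\<close>. If it were not injective, openness of the images of open stars would give an
  overlap of the interiors of two facets \<open>g - {i}\<close> and \<open>g - {j}\<close>. On this overlap the objectives in
  \<open>g - {i, j}\<close> form an open map, and they determine a point of \<open>X*(g)\<close> lying over it; so an open
  subset of \<open>X*(g)\<close> would consist of boundary points only.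
\<close>

section \<open>Coordinate subspaces and invariance of domain\<close>

text \<open>Condition (S1) supplies a homeomorphism onto a simplex for each subproblem separately,
  with no compatibility between that of \<open>g\<close> and those of its subproblems. So nothing
  guarantees beforehand that the Pareto sets of proper subproblems fill the boundary, or that they
  meet along common faces. This is why both properties go through one induction: only when they hold
  for all smaller subproblems can the parametrisations be glued along faces. The resulting boundary
  map is then tested for surjectivity and injectivity separately. No mapping degree is involved,
  only Brouwer's theorem (inside KKM) and invariance of domain. Coning is the common device: it
  turns a map of the boundary into a map of the whole simplex, where invariance of domain is
  available in flat coordinates. Differences of objectives appear because a Pareto set has dimension
  one less than the number of its objectives.\<close>

definition coord_space :: "'a set \<Rightarrow> ('a \<Rightarrow> real) set" where
  "coord_space L = {x. \<forall>i. i \<notin> L \<longrightarrow> x i = 0}"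

lemma continuous_on_coordinate [continuous_intros]:
  "continuous_on S (\<lambda>x::'a \<Rightarrow> 'b::topological_space. x i)"
  by (rule continuous_on_product_then_coordinatewise[OF continuous_on_id])

lemma Rsp_eq_coord_space: "Rsp d = coord_space {..<d}"
  by (auto simp: Rsp_def coord_space_def)

lemma homeomorphism_coord_space_reindex:
  assumes e: "bij_betw e L' L"
  shows "homeomorphism (coord_space L) (coord_space L')
           (\<lambda>x i. if i \<in> L' then x (e i) else 0)
           (\<lambda>y j. if j \<in> L then y (inv_into L' e j) else 0)"
proof (rule homeomorphismI)
  have c: "continuous_on S (\<lambda>(x::'c\<Rightarrow>real) i. if P i then x (k i) else 0)" for S P and k :: "'d \<Rightarrow> 'c"
  proof (rule continuous_on_coordinatewise_then_product)
    fix i show "continuous_on S (\<lambda>x. if P i then x (k i) else (0::real))"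
      by (cases "P i") (auto intro!: continuous_intros)
  qed
  show "continuous_on (coord_space L) (\<lambda>x i. if i \<in> L' then x (e i) else 0)" by (rule c)
  show "continuous_on (coord_space L') (\<lambda>y j. if j \<in> L then y (inv_into L' e j) else 0)" by (rule c)
  show "(\<lambda>y j. if j \<in> L then y (inv_into L' e j) else 0) (\<lambda>i. if i \<in> L' then x (e i) else 0) = x"
    if "x \<in> coord_space L" for x
    using that e bij_betw_inv_into_right[OF e] bij_betw_apply[OF bij_betw_inv_into[OF e]]
    by (auto simp: coord_space_def)
  show "(\<lambda>x i. if i \<in> L' then x (e i) else 0) (\<lambda>j. if j \<in> L then y (inv_into L' e j) else 0) = y"
    if "y \<in> coord_space L'" for y
    using that e bij_betw_inv_into_left[OF e] bij_betw_apply[OF e]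
    by (auto simp: coord_space_def)
qed (auto simp: coord_space_def)

lemma homeomorphism_coord_space_Rsp:
  assumes "finite L" "card L = d"
  obtains u v where "homeomorphism (coord_space L) (Rsp d) u v"
proof -
  obtain e where "bij_betw e {..<d} L"
    using ex_bij_betw_nat_finite[OF assms(1)] assms(2) by (auto simp: atLeast0LessThan)
  from homeomorphism_coord_space_reindex[OF this] show thesis
    by (auto simp: Rsp_eq_coord_space intro: that)
qed

lemma invariance_of_domain_Rsp:
  assumes "openin (top_of_set (Rsp d)) U" "continuous_on U f" "f ` U \<subseteq> Rsp d" "inj_on f U"
  shows "openin (top_of_set (Rsp d)) (f ` U)"
proof -
  have E: "Euclidean_space d = top_of_set (Rsp d)"
    by (simp add: Euclidean_space_def Rsp_def euclidean_product_topology)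
  have "subtopology (Euclidean_space d) U = top_of_set U"
    using openin_imp_subset[OF assms(1)]
    by (simp add: E subtopology_subtopology inf.absorb2)
  then have "continuous_map (subtopology (Euclidean_space d) U) (Euclidean_space d) f"
    using assms(2,3) by (auto simp: E continuous_map_in_subtopology)
  with assms show ?thesis
    using invariance_of_domain_Euclidean_space[of d U f] by (simp add: E)
qed

lemma invariance_of_domain_coord_space:
  fixes f :: "('a \<Rightarrow> real) \<Rightarrow> ('b \<Rightarrow> real)"
  assumes L: "finite L" "finite L'" "card L = card L'"
    and U: "openin (top_of_set (coord_space L)) U"
    and f: "continuous_on U f" "f ` U \<subseteq> coord_space L'" "inj_on f U"
  shows "openin (top_of_set (coord_space L')) (f ` U)"
proof -
  obtain u v where uv: "homeomorphism (coord_space L) (Rsp (card L)) u v"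
    using homeomorphism_coord_space_Rsp L by blast
  obtain u' v' where uv': "homeomorphism (coord_space L') (Rsp (card L)) u' v'"
    using homeomorphism_coord_space_Rsp L by metis
  have sub: "U \<subseteq> coord_space L" using U openin_imp_subset by blast
  have o: "openin (top_of_set (Rsp (card L))) (u ` U)"
    using homeomorphism_imp_open_map[OF uv U] .
  have vu: "v (u x) = x" if "x \<in> U" for x using that sub homeomorphism_apply1[OF uv] by blast
  have vuU: "v ` u ` U = U" using vu by force
  have 1: "continuous_on (u ` U) (u' \<circ> f \<circ> v)"
  proof (intro continuous_on_compose)
    show "continuous_on (u ` U) v"
      by (rule continuous_on_subset[OF homeomorphism_cont2[OF uv]]) (use openin_imp_subset[OF o] in blast)
    show "continuous_on (v ` u ` U) f" by (simp add: vuU f(1))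
    show "continuous_on (f ` v ` u ` U) u'"
      unfolding vuU by (rule continuous_on_subset[OF homeomorphism_cont1[OF uv'] f(2)])
  qed
  have im: "(u' \<circ> f \<circ> v) ` u ` U = u' ` f ` U"
    by (metis image_comp vuU)
  have 2: "(u' \<circ> f \<circ> v) ` u ` U \<subseteq> Rsp (card L)"
    unfolding im using f(2) homeomorphism_image1[OF uv'] by blast
  have 3: "inj_on (u' \<circ> f \<circ> v) (u ` U)"
  proof (rule inj_onI, clarsimp simp: vu)
    fix x y assume "x \<in> U" "y \<in> U" "u' (f x) = u' (f y)"
    moreover then have "f x = f y"
      using f(2) homeomorphism_apply1[OF uv'] by (metis image_subset_iff)
    ultimately show "u x = u y" using f(3) by (metis inj_onD)
  qed
  have "openin (top_of_set (Rsp (card L))) (u' ` f ` U)"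
    using invariance_of_domain_Rsp[OF o 1 2 3] im by simp
  then have "openin (top_of_set (coord_space L')) (v' ` u' ` f ` U)"
    using homeomorphism_imp_open_map[OF homeomorphism_symD[OF uv']] by blast
  moreover have "v' ` u' ` f ` U = f ` U"
    using f(2) homeomorphism_apply1[OF uv'] by (force simp: image_iff)
  ultimately show ?thesis by simp
qed

text \<open>Turns openness of an image into a single point displaced along a chosen curve; each
  later use only has to supply a curve that points in a useful or an impossible direction.\<close>

lemma openin_contains_curve:
  fixes c :: "real \<Rightarrow> 'a::topological_space"
  assumes "openin (top_of_set S) W" "continuous_on {0..d} c" "0 < d" "c ` {0..d} \<subseteq> S" "c 0 \<in> W"
  obtains \<epsilon> where "0 < \<epsilon>" "\<epsilon> \<le> d" "c \<epsilon> \<in> W"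
proof -
  have "openin (top_of_set {0..d}) ({0..d} \<inter> c -` W)"
    using assms continuous_openin_preimage by (metis image_subset_iff_funcset)
  moreover have "0 \<in> {0..d} \<inter> c -` W" using assms by simp
  ultimately obtain e where e: "e > 0" "\<And>x. x \<in> {0..d} \<Longrightarrow> dist x 0 < e \<Longrightarrow> c x \<in> W"
    unfolding openin_euclidean_subtopology_iff by blast
  show thesis
    by (rule that[of "min d (e/2)"]) (use e assms(3) in \<open>auto simp: dist_real_def\<close>)
qed

section \<open>The standard simplex\<close>

definition simplex_interior :: "'a set \<Rightarrow> ('a \<Rightarrow> real) set" where
  "simplex_interior h = {t \<in> std_simplex h. \<forall>i\<in>h. 0 < t i}"

definition simplex_boundary :: "'a set \<Rightarrow> ('a \<Rightarrow> real) set" where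
  "simplex_boundary h = std_simplex h - simplex_interior h"

lemma mem_std_simplex:
  assumes "finite h"
  shows "t \<in> std_simplex h \<longleftrightarrow> (\<forall>i. i \<notin> h \<longrightarrow> t i = 0) \<and> (\<forall>i\<in>h. 0 \<le> t i) \<and> sum t h = 1"
proof -
  have "t i \<le> 1" if "\<forall>i\<in>h. 0 \<le> t i" "sum t h = 1" "i \<in> h" for i
    using member_le_sum[of i h t] that assms by auto
  then show ?thesis by (auto simp: std_simplex_def)
qed

lemma std_simplex_nonneg: "t \<in> std_simplex h \<Longrightarrow> 0 \<le> t i"
  by (cases "i \<in> h") (auto simp: std_simplex_def)

lemma std_simplex_zero: "t \<in> std_simplex h \<Longrightarrow> i \<notin> h \<Longrightarrow> t i = 0"
  by (auto simp: std_simplex_def)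

lemma std_simplex_le_1: "t \<in> std_simplex h \<Longrightarrow> t i \<le> 1"
  by (cases "i \<in> h") (auto simp: std_simplex_def)

text \<open>Since points vanish outside their index set, the face spanned by \<open>h\<close> is
  literally the set \<open>std_simplex h\<close>; maps defined on different faces can thus be glued
  without inclusion maps.\<close>

lemma std_simplex_mono:
  assumes "finite g" "h \<subseteq> g"
  shows "std_simplex h \<subseteq> std_simplex g"
proof
  fix t assume t: "t \<in> std_simplex h"
  have "sum t g = sum t h"
    using assms t by (intro sum.mono_neutral_right) (auto simp: std_simplex_def)
  moreover have "sum t h = 1" using t by (simp add: std_simplex_def)
  ultimately show "t \<in> std_simplex g"
    using t assms std_simplex_nonneg[OF t] std_simplex_zero[OF t] by (auto simp: mem_std_simplex)
qed

lemma std_simplex_face: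
  assumes "finite g" "t \<in> std_simplex g" "h \<subseteq> g" "\<And>i. i \<in> g \<Longrightarrow> i \<notin> h \<Longrightarrow> t i = 0"
  shows "t \<in> std_simplex h"
proof -
  have "sum t g = sum t h"
    using assms by (intro sum.mono_neutral_right) auto
  then show ?thesis
    using assms finite_subset[OF assms(3,1)] by (auto simp: mem_std_simplex)
qed

lemma std_simplex_Int:
  assumes "finite h1" "finite h2"
  shows "std_simplex h1 \<inter> std_simplex h2 = std_simplex (h1 \<inter> h2)"
proof -
  have "std_simplex (h1 \<inter> h2) \<subseteq> std_simplex h1" "std_simplex (h1 \<inter> h2) \<subseteq> std_simplex h2"
    by (rule std_simplex_mono; simp add: assms)+
  then show ?thesis
    using assms std_simplex_face[of h1 _ "h1 \<inter> h2"] std_simplex_zero by fastforce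
qed

lemma simplex_boundary_zero:
  assumes "t \<in> simplex_boundary h"
  obtains i where "i \<in> h" "t i = 0"
proof -
  obtain i where "i \<in> h" "\<not> 0 < t i"
    using assms by (auto simp: simplex_boundary_def simplex_interior_def)
  moreover have "0 \<le> t i" using assms by (auto simp: simplex_boundary_def std_simplex_nonneg)
  ultimately show thesis using that by force
qed

lemma continuous_on_fun_upd:
  fixes f :: "'b::topological_space \<Rightarrow> 'a \<Rightarrow> 'c::topological_space"
  assumes "continuous_on S f" "continuous_on S g"
  shows "continuous_on S (\<lambda>x. (f x)(i := g x))"
proof (rule continuous_on_coordinatewise_then_product)
  fix j show "continuous_on S (\<lambda>x. ((f x)(i := g x)) j)"
    using assms by (cases "j = i") (auto intro: continuous_on_product_then_coordinatewise)
qed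

lemma open_Collect_positive: "finite h \<Longrightarrow> open {t::'a\<Rightarrow>real. \<forall>i\<in>h. 0 < t i}"
proof -
  assume h: "finite h"
  have "{t::'a\<Rightarrow>real. \<forall>i\<in>h. 0 < t i} = (\<Inter>i\<in>h. {t. 0 < t i})" by auto
  moreover have "open (\<Inter>i\<in>h. {t::'a\<Rightarrow>real. 0 < t i})"
    by (rule open_INT[OF h]) (auto intro!: open_Collect_less continuous_intros)
  ultimately show ?thesis by simp
qed

lemma simplex_interior_openin:
  assumes "finite h"
  shows "openin (top_of_set (std_simplex h)) (simplex_interior h)"
proof -
  have "simplex_interior h = std_simplex h \<inter> {t. \<forall>i\<in>h. 0 < t i}"
    by (auto simp: simplex_interior_def)
  then show ?thesis using open_Collect_positive[OF assms] openin_open by blast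
qed

lemma closed_std_simplex:
  assumes "finite h"
  shows "closed (std_simplex h)"
proof -
  have eq: "std_simplex h = {t. \<forall>i. i \<notin> h \<longrightarrow> t i = 0} \<inter> {t. \<forall>i. i \<in> h \<longrightarrow> 0 \<le> t i} \<inter> {t. sum t h = 1}"
    using assms by (auto simp: mem_std_simplex)
  show ?thesis unfolding eq
    by (intro closed_Int closed_Collect_all closed_Collect_imp closed_Collect_eq closed_Collect_le
        continuous_intros open_Collect_const)
qed

section \<open>Dropping a coordinate: flat charts of the simplex and its manifold interior\<close>

lemma inj_on_drop_coordinate:
  assumes "finite h" "i0 \<in> h"
  shows "inj_on (\<lambda>t. t(i0 := 0::real)) {t. sum t h = 1}"
proof (rule inj_onI)
  fix s t :: "'a \<Rightarrow> real"
  assume s: "s \<in> {t. sum t h = 1}" and t: "t \<in> {t. sum t h = 1}" and eq: "s(i0 := 0) = t(i0 := 0)"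
  have e: "s i = t i" if "i \<noteq> i0" for i using fun_cong[OF eq, of i] that by simp
  have "s i0 = 1 - sum s (h - {i0})" "t i0 = 1 - sum t (h - {i0})"
    using s t sum.remove[OF assms, of s] sum.remove[OF assms, of t] by auto
  moreover have "sum s (h - {i0}) = sum t (h - {i0})" using e by (intro sum.cong) auto
  ultimately have "s i0 = t i0" by simp
  with e show "s = t" by (metis ext)
qed

lemma std_simplex_subset_plane: "std_simplex h \<subseteq> {t. sum t h = 1}"
  by (auto simp: std_simplex_def)

lemma continuous_on_drop_coordinate: "continuous_on S (\<lambda>t. t(i0 := (0::real)))"
  by (intro continuous_on_fun_upd continuous_intros)

lemma continuous_on_restore_coordinate:
  "continuous_on S (\<lambda>t. t(i0 := 1 - sum t A :: real))"
  by (intro continuous_on_fun_upd continuous_intros)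

lemma restore_dropped_coordinate:
  fixes t :: "'a \<Rightarrow> real"
  assumes "finite h" "i0 \<in> h" "sum t h = 1"
  shows "(t(i0 := 0))(i0 := 1 - sum (t(i0 := 0)) (h - {i0})) = t"
proof -
  have "sum (t(i0 := 0)) (h - {i0}) = sum t (h - {i0})" by (intro sum.cong) auto
  then have "1 - sum (t(i0 := 0)) (h - {i0}) = t i0" using assms sum.remove[of h i0 t] by simp
  then show ?thesis by auto
qed

text \<open>Inside \<open>simplex_interior h\<close> the equation for the sum is the only active
  constraint, and the dropped coordinate absorbs it; hence the image is the preimage of an open set
  under the continuous map restoring that coordinate.\<close>

lemma openin_drop_coordinate:
  assumes h: "finite h" "i0 \<in> h"
    and U: "openin (top_of_set (std_simplex h)) U" "U \<subseteq> simplex_interior h"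
  shows "openin (top_of_set (coord_space (h - {i0}))) ((\<lambda>t. t(i0 := 0)) ` U)"
proof -
  obtain W where W: "open W" "U = std_simplex h \<inter> W" using U(1) openin_open by blast
  define lift where "lift = (\<lambda>x::'a\<Rightarrow>real. x(i0 := 1 - sum x (h - {i0})))"
  have cl: "continuous_on S lift" for S unfolding lift_def by (rule continuous_on_restore_coordinate)
  have lift_sum: "sum (lift x) h = 1" for x
  proof -
    have "sum (lift x) h = lift x i0 + sum (lift x) (h - {i0})" using sum.remove[OF h] .
    also have "sum (lift x) (h - {i0}) = sum x (h - {i0})"
      by (intro sum.cong) (auto simp: lift_def)
    finally show ?thesis by (simp add: lift_def)
  qed
  have eq: "(\<lambda>t. t(i0 := 0)) ` U = coord_space (h - {i0}) \<inter> lift -` (W \<inter> {t. \<forall>i\<in>h. 0 < t i})" (is "?A = ?B")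
  proof
    show "?A \<subseteq> ?B"
    proof clarify
      fix t assume t: "t \<in> U"
      have ts: "sum t h = 1" "t \<in> std_simplex h" "t \<in> W" "\<forall>i\<in>h. 0 < t i"
        using t U W std_simplex_subset_plane by (auto simp: simplex_interior_def)
      have "lift (t(i0 := 0)) = t"
        unfolding lift_def by (rule restore_dropped_coordinate[OF h ts(1)])
      then show "t(i0 := 0) \<in> ?B"
        using ts by (auto simp: coord_space_def std_simplex_zero)
    qed
    show "?B \<subseteq> ?A"
    proof
      fix x assume x: "x \<in> ?B"
      have "lift x \<in> std_simplex h"
        unfolding mem_std_simplex[OF h(1)]
        using x lift_sum[of x] h by (auto simp: coord_space_def lift_def less_imp_le)
      moreover have "x = (lift x)(i0 := 0)"
        using x by (auto simp: lift_def coord_space_def)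
      ultimately show "x \<in> ?A" using x W by (auto simp: image_iff)
    qed
  qed
  have "open (W \<inter> {t. \<forall>i\<in>h. 0 < t i})" using W open_Collect_positive[OF h(1)] by blast
  then show ?thesis
    unfolding eq by (rule continuous_openin_preimage_gen[OF cl])
qed

lemma invariance_of_domain_simplex:
  fixes f :: "('a \<Rightarrow> real) \<Rightarrow> ('b \<Rightarrow> real)"
  assumes h: "finite h" "h \<noteq> {}" and L: "finite L" "card L = card h - 1"
    and U: "openin (top_of_set (std_simplex h)) U" "U \<subseteq> simplex_interior h"
    and f: "continuous_on U f" "f ` U \<subseteq> coord_space L" "inj_on f U"
  shows "openin (top_of_set (coord_space L)) (f ` U)"
proof -
  obtain i0 where i0: "i0 \<in> h" using h by blast
  define p where "p = (\<lambda>t::'a\<Rightarrow>real. t(i0 := 0))"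
  define lift where "lift = (\<lambda>x::'a\<Rightarrow>real. x(i0 := 1 - sum x (h - {i0})))"
  have Us: "U \<subseteq> {t. sum t h = 1}"
    using openin_imp_subset[OF U(1)] std_simplex_subset_plane by blast
  have lp: "lift (p t) = t" if "t \<in> U" for t
    unfolding lift_def p_def by (rule restore_dropped_coordinate[OF h(1) i0]) (use that Us in blast)
  have lpU: "lift ` p ` U = U" using lp by force
  have o: "openin (top_of_set (coord_space (h - {i0}))) (p ` U)"
    unfolding p_def by (rule openin_drop_coordinate[OF h(1) i0 U])
  have "openin (top_of_set (coord_space L)) ((f \<circ> lift) ` (p ` U))"
  proof (rule invariance_of_domain_coord_space[OF _ L(1) _ o])
    show "finite (h - {i0})" "card (h - {i0}) = card L" using h i0 L by auto
    show "continuous_on (p ` U) (f \<circ> lift)"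
      by (rule continuous_on_compose)
         (simp_all add: lpU f, simp add: lift_def continuous_on_restore_coordinate)
    show "(f \<circ> lift) ` p ` U \<subseteq> coord_space L" using f(2) lpU by (metis image_comp)
    show "inj_on (f \<circ> lift) (p ` U)"
      using f(3) lp by (auto simp: inj_on_def)
  qed
  then show ?thesis using lpU by (metis image_comp)
qed

lemma invariance_of_domain_simplex_self:
  assumes h: "finite h" "h \<noteq> {}"
    and U: "openin (top_of_set (std_simplex h)) U" "U \<subseteq> simplex_interior h"
    and f: "continuous_on U f" "f ` U \<subseteq> std_simplex h" "inj_on f U"
  shows "openin (top_of_set (std_simplex h)) (f ` U)"
proof -
  obtain i0 where i0: "i0 \<in> h" using h by blast
  define p where "p = (\<lambda>t::'a\<Rightarrow>real. t(i0 := 0))"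
  have ip: "inj_on p (std_simplex h)"
    unfolding p_def by (rule inj_on_subset[OF inj_on_drop_coordinate[OF h(1) i0] std_simplex_subset_plane])
  have "openin (top_of_set (coord_space (h - {i0}))) ((p \<circ> f) ` U)"
  proof (rule invariance_of_domain_simplex[OF h _ _ U])
    show "continuous_on U (p \<circ> f)"
      unfolding p_def comp_def by (rule continuous_on_fun_upd[OF f(1) continuous_on_const])
    show "inj_on (p \<circ> f) U" using comp_inj_on[OF f(3)] inj_on_subset[OF ip f(2)] by blast
    show "(p \<circ> f) ` U \<subseteq> coord_space (h - {i0})"
      using f(2) by (auto simp: p_def coord_space_def std_simplex_zero)
  qed (use h i0 in auto)
  then have "openin (top_of_set (std_simplex h)) (std_simplex h \<inter> p -` ((p \<circ> f) ` U))"
    by (rule continuous_openin_preimage[rotated 2])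
       (auto simp: p_def coord_space_def std_simplex_zero continuous_on_drop_coordinate)
  moreover have "std_simplex h \<inter> p -` ((p \<circ> f) ` U) = f ` U"
    using f(2) ip by (auto simp: inj_on_def)
  ultimately show ?thesis by simp
qed

text \<open>One inclusion pulls a flat chart of the simplex interior back along
  \<open>\<phi>\<close>. For the other, a chart around a point composed with \<open>\<phi>\<close>
  has open image in flat coordinates by invariance of domain; if a coordinate of the image point
  vanished, a small move making it negative would have to stay in the simplex.\<close>

lemma mfd_interior_simplex:
  assumes h: "finite h" "h \<noteq> {}" and hom: "homeomorphism S (std_simplex h) \<phi> \<psi>"
  shows "mfd_interior (card h - 1) S = {p \<in> S. \<phi> p \<in> simplex_interior h}"
proof -
  obtain i0 where i0: "i0 \<in> h" using h by blast
  define p where "p = (\<lambda>t::'a\<Rightarrow>real. t(i0 := 0))"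
  have ip: "inj_on p {t. sum t h = 1}"
    unfolding p_def by (rule inj_on_drop_coordinate[OF h(1) i0])
  have cardL: "finite (h - {i0})" "card (h - {i0}) = card h - 1" using h i0 by auto
  obtain u v where uv: "homeomorphism (coord_space (h - {i0})) (Rsp (card h - 1)) u v"
    using homeomorphism_coord_space_Rsp[OF cardL] .
  have \<phi>S: "\<phi> ` S = std_simplex h" using hom homeomorphism_image1 by blast
  show ?thesis
  proof
    show "{p \<in> S. \<phi> p \<in> simplex_interior h} \<subseteq> mfd_interior (card h - 1) S"
    proof clarify
      fix x assume x: "x \<in> S" "\<phi> x \<in> simplex_interior h"
      let ?U = "S \<inter> \<phi> -` simplex_interior h"
      have U: "openin (top_of_set S) ?U"
        by (rule continuous_openin_preimage[OF homeomorphism_cont1[OF hom] _ simplex_interior_openin[OF h(1)]])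
           (use \<phi>S in blast)
      have fU: "\<phi> ` ?U = simplex_interior h" using \<phi>S by (auto simp: simplex_interior_def)
      have 1: "?U homeomorphic simplex_interior h"
        unfolding homeomorphic_def using homeomorphism_of_subsets[OF hom _ _ fU] fU \<phi>S by blast
      have V: "openin (top_of_set (coord_space (h - {i0}))) (p ` simplex_interior h)"
        unfolding p_def by (rule openin_drop_coordinate[OF h(1) i0 simplex_interior_openin[OF h(1)]]) simp
      have lp: "(p t)(i0 := 1 - sum (p t) (h - {i0})) = t" if "t \<in> simplex_interior h" for t
        unfolding p_def by (rule restore_dropped_coordinate[OF h(1) i0])
          (use that in \<open>simp add: simplex_interior_def std_simplex_def\<close>)
      have "homeomorphism (simplex_interior h) (p ` simplex_interior h) p (\<lambda>x. x(i0 := 1 - sum x (h - {i0})))"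
      proof (rule homeomorphismI)
        show "continuous_on (simplex_interior h) p" unfolding p_def by (rule continuous_on_drop_coordinate)
      qed (auto simp: lp continuous_on_restore_coordinate)
      then have 2: "simplex_interior h homeomorphic p ` simplex_interior h"
        unfolding homeomorphic_def by blast
      have 3: "openin (top_of_set (Rsp (card h - 1))) (u ` p ` simplex_interior h)"
        by (rule homeomorphism_imp_open_map[OF uv V])
      have "p ` simplex_interior h homeomorphic u ` p ` simplex_interior h"
        unfolding homeomorphic_def
        using homeomorphism_of_subsets[OF uv openin_imp_subset[OF V] _ refl] openin_imp_subset[OF 3] by blast
      then have "?U homeomorphic u ` p ` simplex_interior h"
        by (rule homeomorphic_trans[OF homeomorphic_trans[OF 1 2]])
      moreover have "x \<in> ?U" using x by simp
      ultimately show "x \<in> mfd_interior (card h - 1) S"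
        unfolding mfd_interior_def using U 3 x(1) by blast
    qed
    show "mfd_interior (card h - 1) S \<subseteq> {p \<in> S. \<phi> p \<in> simplex_interior h}"
    proof
      fix x assume "x \<in> mfd_interior (card h - 1) S"
      then obtain U V k l where x: "x \<in> S" "x \<in> U" and U: "openin (top_of_set S) U"
        and V: "openin (top_of_set (Rsp (card h - 1))) V" and kl: "homeomorphism V U k l"
        unfolding mfd_interior_def homeomorphic_def using homeomorphism_symD by blast
      have US: "U \<subseteq> S" using U openin_imp_subset by blast
      have kV: "k ` V = U" using kl homeomorphism_image1 by blast
      have VR: "openin (top_of_set (coord_space {..<card h - 1})) V" using V by (simp add: Rsp_eq_coord_space)
      have W: "openin (top_of_set (coord_space (h - {i0}))) ((p \<circ> \<phi> \<circ> k) ` V)"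
      proof (rule invariance_of_domain_coord_space[OF _ cardL(1) _ VR])
        show "continuous_on V (p \<circ> \<phi> \<circ> k)"
          by (intro continuous_on_compose homeomorphism_cont1[OF kl])
             (auto simp: kV p_def continuous_on_drop_coordinate
               intro: continuous_on_subset[OF homeomorphism_cont1[OF hom] US])
        show "(p \<circ> \<phi> \<circ> k) ` V \<subseteq> coord_space (h - {i0})"
        proof clarsimp
          fix v assume "v \<in> V"
          then have "\<phi> (k v) \<in> std_simplex h" using kV US \<phi>S by blast
          then show "p (\<phi> (k v)) \<in> coord_space (h - {i0})" by (auto simp: p_def coord_space_def std_simplex_zero)
        qed
        have "inj_on k V" by (metis homeomorphism_apply1[OF kl] inj_onI)
        moreover have "inj_on \<phi> (k ` V)" using US unfolding kV by (metis homeomorphism_apply1[OF hom] inj_onI subsetD)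
        moreover have "inj_on p (\<phi> ` k ` V)"
          by (rule inj_on_subset[OF ip]) (use kV US \<phi>S std_simplex_subset_plane in blast)
        ultimately show "inj_on (p \<circ> \<phi> \<circ> k) V" by (simp add: comp_inj_on image_comp)
      qed (use cardL in auto)
      define t where "t = \<phi> x"
      have t: "t \<in> std_simplex h" using x \<phi>S t_def by blast
      have "0 < t i" if i: "i \<in> h" for i
      proof (rule ccontr)
        assume "\<not> 0 < t i"
        then have ti: "t i = 0" using std_simplex_nonneg[OF t, of i] by simp
        obtain j where j: "j \<in> h" "t j \<noteq> 0"
          using t by (metis mem_std_simplex[OF h(1)] sum.neutral zero_neq_one)
        then have ij: "i \<noteq> j" using ti by auto
        \<comment> \<open>The curve lowers the vanishing coordinate \<open>i\<close> and compensates
          at \<open>j\<close>, so it stays in the plane of sum 1 while leaving the simplex. This is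
          why injectivity of \<open>p\<close> is taken on the plane and not only on the
          simplex.\<close>
        define c where "c = (\<lambda>e::real. t(i := -e, j := t j + e))"
        have sc: "sum (c e) h = 1" for e
        proof -
          have "sum (c e) h = sum (\<lambda>l. t l + (if l = i then -e else 0) + (if l = j then e else 0)) h"
            by (intro sum.cong) (auto simp: c_def ti ij)
          also have "\<dots> = 1" using h i j t by (simp add: sum.distrib std_simplex_def)
          finally show ?thesis .
        qed
        have c0: "c 0 = t" by (auto simp: c_def ti)
        obtain v where v: "v \<in> V" "k v = x" using x kV by blast
        have c1: "(p \<circ> c) 0 \<in> (p \<circ> \<phi> \<circ> k) ` V" using v c0 by (auto simp: t_def image_iff)
        have c2: "(p \<circ> c) ` {0..1} \<subseteq> coord_space (h - {i0})"
          using i j by (auto simp: p_def c_def coord_space_def std_simplex_zero[OF t])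
        have c3: "continuous_on {0..1} (p \<circ> c)"
          unfolding p_def c_def comp_def by (intro continuous_on_fun_upd continuous_intros)
        obtain e where e: "0 < e" "(p \<circ> c) e \<in> (p \<circ> \<phi> \<circ> k) ` V"
          using openin_contains_curve[OF W c3 zero_less_one c2 c1] by blast
        then obtain v where v: "v \<in> V" "p (c e) = p (\<phi> (k v))" by auto
        have s: "\<phi> (k v) \<in> std_simplex h" using v kV US \<phi>S by blast
        then have "c e = \<phi> (k v)"
          using inj_onD[OF ip, OF v(2)] sc std_simplex_subset_plane[of h] by blast
        then have "0 \<le> c e i" using std_simplex_nonneg[OF s] by simp
        then show False using e ij by (simp add: c_def)
      qed
      then show "x \<in> {p \<in> S. \<phi> p \<in> simplex_interior h}" using t x by (auto simp: simplex_interior_def t_def)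
    qed
  qed
qed

section \<open>Cone extension of maps from the boundary of the simplex\<close>

lemma continuous_on_Min_coordinates:
  assumes "finite h" "h \<noteq> {}"
  shows "continuous_on S (\<lambda>t::'a\<Rightarrow>real. Min (t ` h))"
  using assms
proof (induction rule: finite_ne_induct)
  case (singleton i)
  then show ?case by (simp add: continuous_on_coordinate)
next
  case (insert i h)
  then have "(\<lambda>t::'a\<Rightarrow>real. Min (t ` insert i h)) = (\<lambda>t. min (t i) (Min (t ` h)))" by auto
  then show ?case using insert by (auto intro!: continuous_on_min continuous_on_coordinate)
qed

text \<open>Polar coordinates centred at the barycentre: with \<open>m\<close> the least coordinate,
  a point is \<open>m\<close> times the all-ones vector plus the height times a boundary point. The
  height is 1 on the boundary and 0 at the barycentre, where all coordinates equal
  \<open>1 / card h\<close>.\<close>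

definition cone_height :: "'a set \<Rightarrow> ('a \<Rightarrow> real) \<Rightarrow> real" where
  "cone_height h t = 1 - real (card h) * Min (t ` h)"

text \<open>At the barycentre the quotient is a division by zero and yields the zero function, which
  is no boundary point. This default is harmless in \<open>cone_ext\<close>, where the image of the
  base is multiplied by the height, which is 0 there.\<close>

definition cone_base :: "'a set \<Rightarrow> ('a \<Rightarrow> real) \<Rightarrow> ('a \<Rightarrow> real)" where
  "cone_base h t = (\<lambda>i. if i \<in> h then (t i - Min (t ` h)) / cone_height h t else 0)"

definition cone_point :: "'a set \<Rightarrow> real \<Rightarrow> ('a \<Rightarrow> real) \<Rightarrow> ('a \<Rightarrow> real)" where
  "cone_point h m s = (\<lambda>i. if i \<in> h then m + (1 - real (card h) * m) * s i else 0)"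

definition cone_ext :: "'a set \<Rightarrow> (('a \<Rightarrow> real) \<Rightarrow> ('a \<Rightarrow> real)) \<Rightarrow> ('a \<Rightarrow> real) \<Rightarrow> ('a \<Rightarrow> real)" where
  "cone_ext h \<psi> t = cone_point h (Min (t ` h)) (\<psi> (cone_base h t))"

context
  fixes h :: "'a set"
  assumes fin: "finite h" and ne: "h \<noteq> {}"
begin

lemma Min_nonneg: "t \<in> std_simplex h \<Longrightarrow> 0 \<le> Min (t ` h)"
  using fin ne by (auto simp: std_simplex_nonneg)

lemma Min_pos_iff: "t \<in> std_simplex h \<Longrightarrow> 0 < Min (t ` h) \<longleftrightarrow> t \<in> simplex_interior h"
  using fin ne by (auto simp: simplex_interior_def)

lemma Min_zero_iff: "t \<in> std_simplex h \<Longrightarrow> Min (t ` h) = 0 \<longleftrightarrow> t \<in> simplex_boundary h"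
  using Min_nonneg[of t] Min_pos_iff[of t] by (auto simp: simplex_boundary_def)

lemma cone_height_nonneg:
  assumes "t \<in> std_simplex h"
  shows "0 \<le> cone_height h t"
proof -
  have "real (card h) * Min (t ` h) = (\<Sum>i\<in>h. Min (t ` h))" by simp
  also have "\<dots> \<le> sum t h" using fin by (intro sum_mono) auto
  finally show ?thesis using assms by (simp add: cone_height_def std_simplex_def)
qed

lemma cone_base_boundary:
  assumes t: "t \<in> std_simplex h" and pos: "cone_height h t \<noteq> 0"
  shows "cone_base h t \<in> simplex_boundary h"
proof -
  have p: "0 < cone_height h t" using cone_height_nonneg[OF t] pos by simp
  have "sum (cone_base h t) h = (\<Sum>i\<in>h. (t i - Min (t ` h)) / cone_height h t)"
    by (intro sum.cong) (auto simp: cone_base_def)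
  also have "\<dots> = (sum t h - real (card h) * Min (t ` h)) / cone_height h t"
    by (simp add: sum_divide_distrib[symmetric] sum_subtractf)
  also have "\<dots> = 1" using t pos by (simp add: std_simplex_def cone_height_def)
  finally have "sum (cone_base h t) h = 1" .
  then have 1: "cone_base h t \<in> std_simplex h"
    using fin p by (auto simp: mem_std_simplex cone_base_def intro!: divide_nonneg_pos)
  have "Min (t ` h) \<in> t ` h" using fin ne by (intro Min_in) auto
  then obtain i where "i \<in> h" "t i = Min (t ` h)" by auto
  then have "cone_base h t i = 0" "i \<in> h" by (auto simp: cone_base_def)
  then show ?thesis using 1 by (force simp: simplex_boundary_def simplex_interior_def)
qed

lemma cone_base_id:
  assumes "t \<in> simplex_boundary h"
  shows "cone_base h t = t"
proof -
  have t: "t \<in> std_simplex h" using assms by (simp add: simplex_boundary_def)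
  then have "Min (t ` h) = 0" using assms Min_zero_iff by blast
  then show ?thesis using t by (auto simp: cone_base_def cone_height_def std_simplex_zero)
qed

lemma cone_point_decomposition:
  assumes t: "t \<in> std_simplex h"
  shows "cone_point h (Min (t ` h)) (cone_base h t) = t"
proof (cases "cone_height h t = 0")
  case False
  then show ?thesis
    using std_simplex_zero[OF t] by (auto simp: cone_point_def cone_base_def cone_height_def)
next
  case True
  have "(\<Sum>i\<in>h. t i - Min (t ` h)) = 0"
    using True t by (simp add: sum_subtractf cone_height_def std_simplex_def)
  then have "\<forall>i\<in>h. t i - Min (t ` h) = 0"
    using sum_nonneg_eq_0_iff[of h "\<lambda>i. t i - Min (t ` h)"] fin by auto
  then show ?thesis
    using True std_simplex_zero[OF t] by (auto simp: cone_point_def cone_height_def)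
qed

lemma cone_point_in_simplex:
  assumes "s \<in> std_simplex h" "0 \<le> m" "real (card h) * m \<le> 1"
  shows "cone_point h m s \<in> std_simplex h"
proof -
  have "sum (cone_point h m s) h = (\<Sum>i\<in>h. m + (1 - real (card h) * m) * s i)"
    by (intro sum.cong) (auto simp: cone_point_def)
  also have "\<dots> = real (card h) * m + (1 - real (card h) * m) * sum s h"
    by (simp add: sum.distrib sum_distrib_left)
  finally have "sum (cone_point h m s) h = 1" using assms by (simp add: std_simplex_def)
  then show ?thesis
    using assms fin std_simplex_nonneg[OF assms(1)]
    by (auto simp: mem_std_simplex cone_point_def)
qed

lemma Min_cone_point:
  assumes s: "s \<in> simplex_boundary h" and m: "real (card h) * m \<le> 1"
  shows "Min (cone_point h m s ` h) = m"
proof (rule Min_eqI)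
  obtain i where i: "i \<in> h" "s i = 0" using simplex_boundary_zero[OF s] .
  show "m \<in> cone_point h m s ` h" using i by (auto simp: cone_point_def image_iff intro!: bexI[of _ i])
  fix y assume "y \<in> cone_point h m s ` h"
  then show "m \<le> y" using s m std_simplex_nonneg[of s h] by (auto simp: cone_point_def simplex_boundary_def)
qed (use fin in simp)

lemma cone_base_cone_point:
  assumes s: "s \<in> simplex_boundary h" and m: "real (card h) * m < 1"
  shows "cone_base h (cone_point h m s) = s"
proof -
  have "Min (cone_point h m s ` h) = m" using Min_cone_point s m by simp
  moreover then have "cone_height h (cone_point h m s) = 1 - real (card h) * m" by (simp add: cone_height_def)
  ultimately show ?thesis
    using m s std_simplex_zero[of s h] by (auto simp: cone_base_def cone_point_def simplex_boundary_def)
qed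

lemma cone_ext_boundary:
  assumes "t \<in> simplex_boundary h" "\<psi> t \<in> std_simplex h"
  shows "cone_ext h \<psi> t = \<psi> t"
proof -
  have "Min (t ` h) = 0" using assms Min_zero_iff by (auto simp: simplex_boundary_def)
  then show ?thesis using assms std_simplex_zero[OF assms(2)]
    by (auto simp: cone_ext_def cone_base_id cone_point_def)
qed

lemma cone_ext_height_0:
  assumes "t \<in> std_simplex h" "cone_height h t = 0"
  shows "cone_ext h \<psi> t = t"
proof -
  have "cone_ext h \<psi> t = cone_point h (Min (t ` h)) (cone_base h t)"
    using assms(2) by (auto simp: cone_ext_def cone_point_def cone_height_def)
  then show ?thesis using cone_point_decomposition[OF assms(1)] by simp
qed

lemma cone_ext_in_simplex:
  assumes \<psi>: "\<psi> ` simplex_boundary h \<subseteq> std_simplex h" and t: "t \<in> std_simplex h"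
  shows "cone_ext h \<psi> t \<in> std_simplex h"
proof (cases "cone_height h t = 0")
  case True then show ?thesis using cone_ext_height_0 t by simp
next
  case False
  then show ?thesis unfolding cone_ext_def
    using \<psi> cone_base_boundary[OF t False] Min_nonneg[OF t] cone_height_nonneg[OF t]
    by (intro cone_point_in_simplex) (auto simp: cone_height_def)
qed

text \<open>Every coordinate of the image is at least the least coordinate of \<open>t\<close>,
  which is positive: the cone only adds a nonnegative multiple of a simplex point to that
  level.\<close>

lemma cone_ext_interior:
  assumes \<psi>: "\<psi> ` simplex_boundary h \<subseteq> std_simplex h" and t: "t \<in> simplex_interior h"
  shows "cone_ext h \<psi> t \<in> simplex_interior h"
proof -
  have ts: "t \<in> std_simplex h" using t by (simp add: simplex_interior_def)
  have m: "0 < Min (t ` h)" using Min_pos_iff[OF ts] t by simp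
  show ?thesis
  proof (cases "cone_height h t = 0")
    case True then show ?thesis using cone_ext_height_0 ts t by simp
  next
    case False
    then have "\<psi> (cone_base h t) \<in> std_simplex h" using cone_base_boundary[OF ts] \<psi> by blast
    then have "0 < cone_ext h \<psi> t i" if "i \<in> h" for i
      using that m cone_height_nonneg[OF ts] std_simplex_nonneg[of "\<psi> (cone_base h t)" h i]
      by (simp add: cone_ext_def cone_point_def cone_height_def add_pos_nonneg)
    then show ?thesis using cone_ext_in_simplex[OF \<psi> ts] by (simp add: simplex_interior_def)
  qed
qed

lemma Min_cone_ext:
  assumes \<psi>: "\<psi> ` simplex_boundary h \<subseteq> simplex_boundary h" and t: "t \<in> std_simplex h"
  shows "Min (cone_ext h \<psi> t ` h) = Min (t ` h)"
proof (cases "cone_height h t = 0")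
  case True then show ?thesis using cone_ext_height_0 t by simp
next
  case False
  then show ?thesis unfolding cone_ext_def
    using \<psi> cone_base_boundary[OF t False] cone_height_nonneg[OF t]
    by (intro Min_cone_point) (auto simp: cone_height_def)
qed

lemma cone_base_cone_ext:
  assumes \<psi>: "\<psi> ` simplex_boundary h \<subseteq> simplex_boundary h"
    and t: "t \<in> std_simplex h" "cone_height h t \<noteq> 0"
  shows "cone_base h (cone_ext h \<psi> t) = \<psi> (cone_base h t)"
  unfolding cone_ext_def
  using \<psi> cone_base_boundary[OF t] cone_height_nonneg[OF t(1)] t(2)
  by (intro cone_base_cone_point) (auto simp: cone_height_def)

text \<open>The least coordinate is preserved, so two points with the same image lie at the same
  height and only their bases remain to be compared. Injectivity of \<open>\<psi>\<close> is assumed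
  just for this pair of bases, which allows its use where \<open>\<psi>\<close> is injective only on
  a star.\<close>

lemma cone_ext_eq_imp_eq:
  assumes \<psi>: "\<psi> ` simplex_boundary h \<subseteq> simplex_boundary h"
    and s: "s \<in> std_simplex h" and t: "t \<in> std_simplex h"
    and inj: "cone_height h s \<noteq> 0 \<Longrightarrow> cone_height h t \<noteq> 0 \<Longrightarrow>
       \<psi> (cone_base h s) = \<psi> (cone_base h t) \<Longrightarrow> cone_base h s = cone_base h t"
    and eq: "cone_ext h \<psi> s = cone_ext h \<psi> t"
  shows "s = t"
proof -
  have m: "Min (s ` h) = Min (t ` h)"
    using Min_cone_ext[OF \<psi> s] Min_cone_ext[OF \<psi> t] eq by simp
  then have ch: "cone_height h s = cone_height h t" by (simp add: cone_height_def)
  show ?thesis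
  proof (cases "cone_height h s = 0")
    case True
    have "cone_height h t = 0" using ch True by simp
    with eq show ?thesis
      by (simp only: cone_ext_height_0[OF s True] cone_ext_height_0[OF t])
  next
    case False
    then have "\<psi> (cone_base h s) = \<psi> (cone_base h t)"
      using cone_base_cone_ext[OF \<psi> s] cone_base_cone_ext[OF \<psi> t] ch by (simp add: eq)
    then have "cone_base h s = cone_base h t" using False ch by (intro inj) auto
    then have "cone_point h (Min (s ` h)) (cone_base h s) = cone_point h (Min (t ` h)) (cone_base h t)"
      by (simp only: m)
    then show ?thesis unfolding cone_point_decomposition[OF s] cone_point_decomposition[OF t] .
  qed
qed

lemma inj_on_cone_ext:
  assumes \<psi>: "\<psi> ` simplex_boundary h \<subseteq> simplex_boundary h" and inj: "inj_on \<psi> (simplex_boundary h)"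
  shows "inj_on (cone_ext h \<psi>) (std_simplex h)"
proof (rule inj_onI)
  fix s t assume s: "s \<in> std_simplex h" and t: "t \<in> std_simplex h"
    and eq: "cone_ext h \<psi> s = cone_ext h \<psi> t"
  show "s = t"
    by (rule cone_ext_eq_imp_eq[OF \<psi> s t _ eq])
       (rule inj_onD[OF inj], auto intro: cone_base_boundary s t)
qed

lemma cone_ext_surj:
  assumes \<psi>: "\<psi> ` simplex_boundary h = simplex_boundary h"
  shows "cone_ext h \<psi> ` std_simplex h = std_simplex h"
proof
  show "cone_ext h \<psi> ` std_simplex h \<subseteq> std_simplex h"
    using cone_ext_in_simplex \<psi> by (auto simp: simplex_boundary_def)
  show "std_simplex h \<subseteq> cone_ext h \<psi> ` std_simplex h"
  proof
    fix s assume s: "s \<in> std_simplex h"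
    show "s \<in> cone_ext h \<psi> ` std_simplex h"
    proof (cases "cone_height h s = 0")
      case True then show ?thesis using cone_ext_height_0[OF s, of \<psi>] s by force
    next
      case False
      then obtain q where q: "q \<in> simplex_boundary h" "\<psi> q = cone_base h s"
        using cone_base_boundary[OF s] \<psi> by force
      let ?m = "Min (s ` h)"
      have m: "0 \<le> ?m" "real (card h) * ?m < 1"
        using Min_nonneg[OF s] cone_height_nonneg[OF s] False by (auto simp: cone_height_def)
      have "cone_ext h \<psi> (cone_point h ?m q) = cone_point h ?m (cone_base h s)"
        using q m by (simp add: cone_ext_def cone_base_cone_point Min_cone_point)
      moreover have "cone_point h ?m q \<in> std_simplex h"
        using q m by (intro cone_point_in_simplex) (auto simp: simplex_boundary_def)
      ultimately show ?thesis using cone_point_decomposition[OF s] by force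
    qed
  qed
qed

text \<open>The base need not have a limit at the barycentre, but the values of
  \<open>\<psi>\<close> have coordinates between 0 and 1, so their product with the height tends to
  0 there. Elsewhere the extension is composed of continuous maps.\<close>

lemma continuous_on_cone_ext:
  assumes cont: "continuous_on (simplex_boundary h) \<psi>" and \<psi>: "\<psi> ` simplex_boundary h \<subseteq> std_simplex h"
  shows "continuous_on (std_simplex h) (cone_ext h \<psi>)"
proof (rule continuous_on_coordinatewise_then_product)
  fix i
  let ?D = "std_simplex h"
  have cm: "continuous_on S (\<lambda>t::'a\<Rightarrow>real. Min (t ` h))" for S
    by (rule continuous_on_Min_coordinates[OF fin ne])
  have ch: "continuous_on S (cone_height h)" for S
  proof -
    have "continuous_on S (\<lambda>t. 1 - real (card h) * Min (t ` h))" by (intro continuous_intros cm)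
    then show ?thesis by (simp add: cone_height_def[abs_def])
  qed
  have op: "open {t. cone_height h t \<noteq> 0}"
    by (rule open_Collect_neq[OF ch continuous_on_const])
  show "continuous_on ?D (\<lambda>t. cone_ext h \<psi> t i)"
  proof (cases "i \<in> h")
    case False then show ?thesis by (simp add: cone_ext_def cone_point_def)
  next
    case True
    have eq: "cone_ext h \<psi> t i = Min (t ` h) + cone_height h t * \<psi> (cone_base h t) i" for t
      using True by (simp add: cone_ext_def cone_point_def cone_height_def)
    let ?k = "\<lambda>t. cone_height h t * \<psi> (cone_base h t) i"
    let ?E = "?D \<inter> {t. cone_height h t \<noteq> 0}"
    have "continuous_on ?E (cone_base h)"
    proof (rule continuous_on_coordinatewise_then_product)
      fix j show "continuous_on ?E (\<lambda>t. cone_base h t j)"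
        unfolding cone_base_def
        by (cases "j \<in> h") (auto intro!: continuous_on_divide continuous_on_diff continuous_on_coordinate cm ch)
    qed
    then have "continuous_on ?E (\<psi> \<circ> cone_base h)"
      by (rule continuous_on_compose) (rule continuous_on_subset[OF cont], auto intro: cone_base_boundary)
    then have "continuous_on ?E (\<lambda>t. \<psi> (cone_base h t) i)"
      using continuous_on_product_then_coordinatewise[of ?E "\<lambda>t. \<psi> (cone_base h t)" i] by (simp add: comp_def)
    then have cE: "continuous_on ?E ?k" by (intro continuous_on_mult ch)
    have "continuous_on ?D ?k"
      unfolding continuous_on_def
    proof
      fix t assume t: "t \<in> ?D"
      show "(?k \<longlongrightarrow> ?k t) (at t within ?D)"
      proof (cases "cone_height h t = 0")
        case False
        then have "(?k \<longlongrightarrow> ?k t) (at t within ?E)" using cE t unfolding continuous_on_def by blast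
        moreover have "at t within ?E = at t within ?D"
          using False by (intro at_within_nhd[OF _ op]) auto
        ultimately show ?thesis by simp
      next
        case True
        have "(cone_height h \<longlongrightarrow> 0) (at t within ?D)"
          using ch[of ?D] t True unfolding continuous_on_def by force
        moreover have "\<bar>?k s\<bar> \<le> cone_height h s" if s: "s \<in> ?D" for s
        proof (cases "cone_height h s = 0")
          case False
          then have "\<psi> (cone_base h s) \<in> ?D" using \<psi> cone_base_boundary[OF s] by blast
          then show ?thesis
            using cone_height_nonneg[OF s] std_simplex_le_1[of _ h i] std_simplex_nonneg[of _ h i]
            by (simp add: abs_mult mult_left_le)
        qed simp
        then have "eventually (\<lambda>s. norm (?k s) \<le> cone_height h s) (at t within ?D)"
          by (auto simp: eventually_at_filter)
        ultimately have "(?k \<longlongrightarrow> 0) (at t within ?D)" by (rule Lim_null_comparison[rotated])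
        then show ?thesis using True by simp
      qed
    qed
    then show ?thesis unfolding eq by (intro continuous_on_add cm)
  qed
qed

end

section \<open>Fixed points and boundary maps of the simplex\<close>

text \<open>Brouwer's theorem is applied in \<open>real^'k\<close>: \<open>B\<close> places the
  simplex on the coordinates in the range of an injection \<open>e\<close> of \<open>g\<close> into
  \<open>'k\<close>, and \<open>A\<close> reads them back. This is where a bound on the number of
  indices enters.\<close>

lemma std_simplex_fixpoint:
  fixes g :: "'a set" and T :: "('a \<Rightarrow> real) \<Rightarrow> 'a \<Rightarrow> real"
  assumes fin: "finite g" and ne: "g \<noteq> {}" and card: "card g \<le> CARD('k::finite)"
    and T: "continuous_on (std_simplex g) T" "T ` std_simplex g \<subseteq> std_simplex g"
  obtains t where "t \<in> std_simplex g" "T t = t"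
proof -
  obtain e :: "'a \<Rightarrow> 'k" where e: "inj_on e g"
    using card_le_inj[of g "UNIV :: 'k set"] fin card by auto
  define Q where "Q = {v::real^'k. (\<forall>a. 0 \<le> v $ a) \<and> (\<forall>a. a \<notin> e ` g \<longrightarrow> v $ a = 0) \<and> (\<Sum>a\<in>UNIV. v $ a) = 1}"
  define A where "A = (\<lambda>v::real^'k. \<lambda>i. if i \<in> g then v $ e i else 0)"
  define B where "B = (\<lambda>t::'a\<Rightarrow>real. \<chi> a. if a \<in> e ` g then t (inv_into g e a) else 0)"
  have sumA: "(\<Sum>a\<in>UNIV. v $ a) = (\<Sum>i\<in>g. v $ e i)" if "\<forall>a. a \<notin> e ` g \<longrightarrow> v $ a = 0" for v :: "real^'k"
  proof -
    have "(\<Sum>a\<in>UNIV. v $ a) = (\<Sum>a\<in>e ` g. v $ a)"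
      by (rule sum.mono_neutral_right) (use that in auto)
    then show ?thesis using e by (simp add: sum.reindex)
  qed
  have AQ: "A ` Q \<subseteq> std_simplex g"
    using fin sumA by (auto simp: mem_std_simplex Q_def A_def)
  have Be: "B t $ e i = t i" if "i \<in> g" for t i
    using that e by (simp add: B_def)
  have BQ: "B ` std_simplex g \<subseteq> Q"
  proof clarify
    fix t assume t: "t \<in> std_simplex g"
    have z: "\<forall>a. a \<notin> e ` g \<longrightarrow> B t $ a = 0" by (simp add: B_def)
    have "(\<Sum>a\<in>UNIV. B t $ a) = 1"
      using sumA[OF z] t Be[of _ t] by (simp add: std_simplex_def)
    then show "B t \<in> Q" using z std_simplex_nonneg[OF t] by (auto simp: Q_def B_def)
  qed
  have AB: "A (B t) = t" if "t \<in> std_simplex g" for t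
    using std_simplex_zero[OF that] by (auto simp: A_def Be)
  have cA: "continuous_on Q A"
  proof (rule continuous_on_coordinatewise_then_product)
    fix i show "continuous_on Q (\<lambda>v. A v i)"
      unfolding A_def by (cases "i \<in> g") (auto intro!: continuous_intros)
  qed
  have cB: "continuous_on (std_simplex g) B"
    unfolding B_def
  proof (rule continuous_on_vec_lambda)
    fix a show "continuous_on (std_simplex g) (\<lambda>t. if a \<in> e ` g then t (inv_into g e a) else 0)"
      by (cases "a \<in> e ` g") (simp_all add: continuous_on_coordinate)
  qed
  have "compact Q"
  proof (rule compact_eq_bounded_closed[THEN iffD2], rule conjI)
    show "bounded Q"
    proof (rule boundedI)
      fix v assume v: "v \<in> Q"
      have "norm v \<le> (\<Sum>a\<in>UNIV. \<bar>v $ a\<bar>)" by (rule norm_le_l1_cart)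
      also have "\<dots> = 1" using v by (simp add: Q_def)
      finally show "norm v \<le> 1" .
    qed
    have "Q = {v. \<forall>a. 0 \<le> v $ a} \<inter> {v. \<forall>a. a \<notin> e ` g \<longrightarrow> v $ a = 0} \<inter> {v. (\<Sum>a\<in>UNIV. v $ a) = 1}"
      by (auto simp: Q_def)
    moreover have "closed \<dots>"
      by (intro closed_Int closed_Collect_all closed_Collect_imp closed_Collect_eq closed_Collect_le
          continuous_intros open_Collect_const)
    ultimately show "closed Q" by simp
  qed
  moreover have "convex Q"
    by (rule convexI) (auto simp: Q_def sum.distrib sum_distrib_left[symmetric])
  moreover have "Q \<noteq> {}"
  proof -
    obtain i where i: "i \<in> g" using ne by blast
    have "(\<lambda>j. if j = i then 1 else 0) \<in> std_simplex g"
      using i fin by (auto simp: mem_std_simplex)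
    then show ?thesis using BQ by blast
  qed
  moreover have "continuous_on Q (B \<circ> (T \<circ> A))"
    by (intro continuous_on_compose cA continuous_on_subset[OF T(1) AQ] continuous_on_subset[OF cB])
       (use T(2) AQ in \<open>auto simp: image_subset_iff\<close>)
  moreover have "B \<circ> (T \<circ> A) \<in> Q \<rightarrow> Q"
    using AQ BQ T(2) by (auto simp: image_subset_iff)
  ultimately obtain v where v: "v \<in> Q" "(B \<circ> (T \<circ> A)) v = v" by (rule brouwer)
  then have "T (A v) \<in> std_simplex g" using AQ T(2) by blast
  then have "T (A v) = A v" using AB[of "T (A v)"] v(2) by simp
  moreover have "A v \<in> std_simplex g" using AQ v by blast
  ultimately show thesis using that by blast
qed

text \<open>An open version of the Knaster--Kuratowski--Mazurkiewicz lemma; the fixed point is that of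
  Nash's map for the payoffs \<open>a\<close>.\<close>

lemma kkm_open:
  fixes g :: "'a set" and a :: "'a \<Rightarrow> ('a \<Rightarrow> real) \<Rightarrow> real"
  assumes fin: "finite g" and ne: "g \<noteq> {}" and card: "card g \<le> CARD('k::finite)"
    and cont: "\<And>i. i \<in> g \<Longrightarrow> continuous_on (std_simplex g) (a i)"
    and face: "\<And>t. t \<in> std_simplex g \<Longrightarrow> \<exists>i\<in>g. 0 < t i \<and> a i t < 0"
  obtains t where "t \<in> std_simplex g" "\<And>i. i \<in> g \<Longrightarrow> a i t < 0"
proof -
  \<comment> \<open>The point \<open>t\<close> is read as a mixed strategy: \<open>avg\<close> is
    its mean payoff and \<open>p i\<close> the gain of the pure strategy \<open>i\<close> over it.
    \<open>T\<close> shifts weight towards strategies that gain, normalised by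
    \<open>1 + P t\<close>, which is at least 1.\<close>
  define avg where "avg t = (\<Sum>j\<in>g. t j * a j t)" for t
  define p where "p i t = max 0 (a i t - avg t)" for i t
  define P where "P t = (\<Sum>j\<in>g. p j t)" for t
  define T where "T t = (\<lambda>i. if i \<in> g then (t i + p i t) / (1 + P t) else 0)" for t
  have p0: "0 \<le> p i t" for i t by (simp add: p_def)
  have P0: "0 \<le> P t" for t by (simp add: P_def p0 sum_nonneg)
  have cavg: "continuous_on (std_simplex g) avg"
    unfolding avg_def[abs_def] by (intro continuous_on_sum continuous_on_mult continuous_on_coordinate cont)
  have cp: "continuous_on (std_simplex g) (p i)" if "i \<in> g" for i
    unfolding p_def[abs_def] by (intro continuous_on_max continuous_on_const continuous_on_diff cont cavg that)
  have cP: "continuous_on (std_simplex g) P"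
    unfolding P_def[abs_def] by (intro continuous_on_sum cp)
  have cT: "continuous_on (std_simplex g) T"
  proof (rule continuous_on_coordinatewise_then_product)
    fix i
    have "1 + P t \<noteq> 0" for t using P0[of t] by linarith
    then show "continuous_on (std_simplex g) (\<lambda>t. T t i)"
      unfolding T_def
      by (cases "i \<in> g")
         (auto intro!: continuous_on_divide continuous_on_add continuous_on_coordinate cp cP)
  qed
  have TD: "T ` std_simplex g \<subseteq> std_simplex g"
  proof clarify
    fix t assume t: "t \<in> std_simplex g"
    have "sum (T t) g = (\<Sum>i\<in>g. (t i + p i t) / (1 + P t))"
      by (intro sum.cong) (auto simp: T_def)
    also have "\<dots> = (sum t g + P t) / (1 + P t)"
      by (simp add: sum_divide_distrib[symmetric] sum.distrib P_def)
    also have "\<dots> = 1" using t P0[of t] by (simp add: std_simplex_def)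
    finally have "sum (T t) g = 1" .
    then show "T t \<in> std_simplex g"
      using P0[of t] p0 std_simplex_nonneg[OF t] by (auto simp: mem_std_simplex[OF fin] T_def)
  qed
  obtain t where t: "t \<in> std_simplex g" "T t = t"
    using std_simplex_fixpoint[OF fin ne card cT TD] .
  have st: "sum t g = 1" using t by (simp add: std_simplex_def)
  have pt: "p i t = t i * P t" if "i \<in> g" for i
  proof -
    have "t i = (t i + p i t) / (1 + P t)" using fun_cong[OF t(2), of i] that by (simp add: T_def)
    then show ?thesis using P0[of t] by (simp add: field_simps)
  qed
  have dev: "(\<Sum>j\<in>g. t j * (avg t - a j t)) = 0"
  proof -
    have "(\<Sum>j\<in>g. t j * (avg t - a j t)) = sum t g * avg t - avg t"
      by (simp add: right_diff_distrib sum_subtractf sum_distrib_right[symmetric] avg_def)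
    then show ?thesis by (simp add: st)
  qed
  \<comment> \<open>At a fixed point the gains are proportional to the weights. If their sum were
    positive, every index of positive weight would have payoff above the mean, although the weighted
    deviations from the mean cancel.\<close>
  have "P t = 0"
  proof (rule ccontr)
    assume "P t \<noteq> 0"
    then have Pp: "0 < P t" using P0[of t] by simp
    obtain i where i: "i \<in> g" "0 < t i" using face[OF t(1)] by blast
    have le: "t j * (avg t - a j t) \<le> 0" if "j \<in> g" for j
    proof (cases "t j = 0")
      case False
      then have "0 < t j" using std_simplex_nonneg[OF t(1), of j] by simp
      then have "0 < p j t" using pt[OF that] Pp by simp
      then have "avg t - a j t \<le> 0" by (simp add: p_def)
      then show ?thesis using \<open>0 < t j\<close> by (simp add: mult_nonneg_nonpos)
    qed simp
    have "0 < p i t" using pt[OF i(1)] Pp i by simp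
    then have "t i * (avg t - a i t) < 0" using i by (simp add: p_def mult_pos_neg)
    then have "(\<Sum>j\<in>g. t j * (avg t - a j t)) < (\<Sum>j\<in>g. 0)"
      using fin le i by (intro sum_strict_mono_ex1) auto
    then show False using dev by simp
  qed
  then have "p i t = 0" if "i \<in> g" for i using pt[OF that] by simp
  then have le: "a i t \<le> avg t" if "i \<in> g" for i using that by (fastforce simp: p_def)
  \<comment> \<open>All payoffs are at most the mean, hence equal to it on the support of
    \<open>t\<close>; the index given by \<open>face\<close> lies in the support and has negative
    payoff, so the mean is negative.\<close>
  obtain i where i: "i \<in> g" "0 < t i" "a i t < 0" using face[OF t(1)] by blast
  have "\<forall>j\<in>g. t j * (avg t - a j t) = 0"
    using dev le std_simplex_nonneg[OF t(1)] by (subst (asm) sum_nonneg_eq_0_iff[OF fin]) auto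
  then have "avg t = a i t" using i by auto
  then have "a j t < 0" if "j \<in> g" for j using le[OF that] i by simp
  then show thesis using that t by blast
qed

section \<open>Faces, stars and identifications in the boundary of the simplex\<close>

lemma simplex_boundary_eq_facets:
  assumes "finite g"
  shows "simplex_boundary g = (\<Union>i\<in>g. std_simplex (g - {i}))"
proof
  show "simplex_boundary g \<subseteq> (\<Union>i\<in>g. std_simplex (g - {i}))"
  proof
    fix t assume t: "t \<in> simplex_boundary g"
    then have ts: "t \<in> std_simplex g" by (simp add: simplex_boundary_def)
    obtain i where i: "i \<in> g" "t i = 0" using simplex_boundary_zero[OF t] .
    then have "t \<in> std_simplex (g - {i})" using std_simplex_face[OF assms ts, of "g - {i}"] by auto
    then show "t \<in> (\<Union>i\<in>g. std_simplex (g - {i}))" using i by blast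
  qed
  show "(\<Union>i\<in>g. std_simplex (g - {i})) \<subseteq> simplex_boundary g"
  proof
    fix t assume "t \<in> (\<Union>i\<in>g. std_simplex (g - {i}))"
    then obtain i where i: "i \<in> g" "t \<in> std_simplex (g - {i})" by blast
    have "t i = 0" using std_simplex_zero[OF i(2), of i] by simp
    moreover have "t \<in> std_simplex g" using i std_simplex_mono[OF assms, of "g - {i}"] by blast
    ultimately show "t \<in> simplex_boundary g" using i by (force simp: simplex_boundary_def simplex_interior_def)
  qed
qed

lemma std_simplex_proper_face_boundary:
  assumes "finite g" "h \<subset> g"
  shows "std_simplex h \<subseteq> simplex_boundary g"
proof -
  obtain i where "i \<in> g" "h \<subseteq> g - {i}" using assms(2) by blast
  then show ?thesis
    using std_simplex_mono[of "g - {i}" h] assms(1) by (auto simp: simplex_boundary_eq_facets)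
qed

text \<open>A small step towards the barycentre of \<open>h\<close> makes all coordinates positive.
  The ambient set \<open>S\<close> is general because \<open>W\<close> is later open in the simplex
  itself or in the boundary of a larger simplex.\<close>

lemma simplex_interior_dense:
  assumes h: "finite h" and S: "std_simplex h \<subseteq> S"
    and W: "openin (top_of_set S) W" and t: "t \<in> std_simplex h" "t \<in> W"
  obtains t' where "t' \<in> simplex_interior h" "t' \<in> W"
proof -
  have ne: "h \<noteq> {}" using t(1) by (auto simp: std_simplex_def)
  then have c: "0 < real (card h)" using h by (simp add: card_gt_0_iff)
  define c where "c = (\<lambda>e::real. \<lambda>i. if i \<in> h then (1 - e) * t i + e * (1 / real (card h)) else 0)"
  have cs: "c e \<in> std_simplex h" if "0 \<le> e" "e \<le> 1" for e
  proof -
    have "sum (c e) h = (\<Sum>i\<in>h. (1 - e) * t i + e * (1 / real (card h)))"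
      by (intro sum.cong) (auto simp: c_def)
    also have "\<dots> = (1 - e) * sum t h + e"
      using c by (simp add: sum.distrib sum_distrib_left)
    finally have "sum (c e) h = 1" using t by (simp add: std_simplex_def)
    then show ?thesis using that std_simplex_nonneg[OF t(1)] by (auto simp: mem_std_simplex[OF h] c_def)
  qed
  have "continuous_on {0..1} c"
  proof (rule continuous_on_coordinatewise_then_product)
    fix i show "continuous_on {0..1} (\<lambda>e. c e i)"
      unfolding c_def by (cases "i \<in> h") (use ne h in \<open>auto intro!: continuous_intros\<close>)
  qed
  moreover have "c ` {0..1} \<subseteq> S" using cs S by auto
  moreover have "c 0 \<in> W"
  proof -
    have "c 0 = t" using std_simplex_zero[OF t(1)] by (auto simp: c_def)
    then show ?thesis using t by simp
  qed
  ultimately obtain e where e: "0 < e" "e \<le> 1" "c e \<in> W"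
    using openin_contains_curve[OF W _ zero_less_one] by blast
  have "0 < c e i" if "i \<in> h" for i
    using that e c std_simplex_nonneg[OF t(1), of i] by (auto simp: c_def intro!: add_nonneg_pos)
  then show thesis using that[of "c e"] e cs[of e] by (simp add: simplex_interior_def)
qed

text \<open>The boundary is not flat, so invariance of domain is applied one dimension higher: the
  open cone over the star has an open image under the cone extension, and the slice of that image at
  a fixed level is a copy of the image of the star.\<close>

lemma openin_boundary_star_image:
  assumes fin: "finite g" and h: "h \<noteq> {}" "h \<subseteq> g"
    and cont: "continuous_on (simplex_boundary g) \<theta>" and \<theta>: "\<theta> ` simplex_boundary g \<subseteq> simplex_boundary g"
    and inj: "inj_on \<theta> {t \<in> simplex_boundary g. \<forall>i\<in>h. 0 < t i}" (is "inj_on \<theta> ?St")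
  shows "openin (top_of_set (simplex_boundary g)) (\<theta> ` ?St)"
proof -
  have ne: "g \<noteq> {}" using h by blast
  note [simp] = fin ne
  have bd: "simplex_boundary g \<subseteq> std_simplex g" by (auto simp: simplex_boundary_def)
  have \<theta>D: "\<theta> ` simplex_boundary g \<subseteq> std_simplex g" using \<theta> bd by blast
  \<comment> \<open>The open cone over the star: exceeding the least coordinate on \<open>h\<close>
    means that the base is positive on \<open>h\<close>. As \<open>h\<close> is nonempty, this also
    excludes the barycentre, where the base has only its default value.\<close>
  define C where "C = {t \<in> simplex_interior g. \<forall>i\<in>h. Min (t ` g) < t i}"
  have finh: "finite h" using h fin finite_subset by blast
  have CD: "C \<subseteq> std_simplex g" "C \<subseteq> simplex_interior g" by (auto simp: C_def simplex_interior_def)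
  have "open {t::'a\<Rightarrow>real. \<forall>i\<in>h. Min (t ` g) < t i}"
  proof -
    have "open (\<Inter>i\<in>h. {t::'a\<Rightarrow>real. Min (t ` g) < t i})"
      by (rule open_INT[OF finh])
         (auto intro!: open_Collect_less continuous_on_Min_coordinates continuous_on_coordinate)
    moreover have "{t::'a\<Rightarrow>real. \<forall>i\<in>h. Min (t ` g) < t i} = (\<Inter>i\<in>h. {t. Min (t ` g) < t i})" by auto
    ultimately show ?thesis by simp
  qed
  then have "openin (top_of_set (std_simplex g)) (simplex_interior g \<inter> {t. \<forall>i\<in>h. Min (t ` g) < t i})"
    by (rule openin_Int_open[OF simplex_interior_openin[OF fin]])
  moreover have "C = simplex_interior g \<inter> {t. \<forall>i\<in>h. Min (t ` g) < t i}" by (auto simp: C_def)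
  ultimately have C: "openin (top_of_set (std_simplex g)) C" by simp
  have hC: "cone_height g t \<noteq> 0" if t: "t \<in> C" for t
  proof
    assume 0: "cone_height g t = 0"
    obtain i where "i \<in> h" using h by blast
    then have i: "i \<in> g" "Min (t ` g) < t i" using t h by (auto simp: C_def)
    have "cone_point g (Min (t ` g)) (cone_base g t) i = t i"
      using cone_point_decomposition[OF fin ne, of t] t CD by auto
    then show False using i 0 by (simp add: cone_point_def cone_height_def)
  qed
  have bC: "cone_base g t \<in> ?St" if t: "t \<in> C" for t
  proof -
    have tD: "t \<in> std_simplex g" using t CD by blast
    have "0 < cone_height g t" using hC[OF t] cone_height_nonneg[OF fin ne tD] by simp
    then have "0 < cone_base g t i" if "i \<in> h" for i
      using that t h by (auto simp: cone_base_def C_def)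
    then show ?thesis using cone_base_boundary[OF fin ne tD hC[OF t]] by blast
  qed
  have "inj_on (cone_ext g \<theta>) C"
  proof (rule inj_onI)
    fix s t assume st: "s \<in> C" "t \<in> C" and eq: "cone_ext g \<theta> s = cone_ext g \<theta> t"
    have sD: "s \<in> std_simplex g" and tD: "t \<in> std_simplex g" using st CD by auto
    show "s = t"
      by (rule cone_ext_eq_imp_eq[OF fin ne \<theta> sD tD _ eq])
         (erule inj_onD[OF inj _ bC[OF st(1)] bC[OF st(2)]])
  qed
  moreover have "continuous_on C (cone_ext g \<theta>)"
    by (rule continuous_on_subset[OF continuous_on_cone_ext[OF fin ne cont \<theta>D] CD(1)])
  moreover have "cone_ext g \<theta> ` C \<subseteq> std_simplex g"
    using cone_ext_in_simplex[OF fin ne \<theta>D] CD by blast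
  ultimately have op: "openin (top_of_set (std_simplex g)) (cone_ext g \<theta> ` C)"
    by (intro invariance_of_domain_simplex_self[OF fin ne C CD(2)])
  \<comment> \<open>Any level strictly between 0 (the boundary) and \<open>1 / card g\<close> (the
    barycentre) would do; half of the latter is taken.\<close>
  define m where "m = 1 / (2 * real (card g))"
  have m: "0 < m" "real (card g) * m < 1" "real (card g) * m \<le> 1"
    using card_gt_0_iff[of g] by (auto simp: m_def)
  have cm: "continuous_on (simplex_boundary g) (cone_point g m)"
  proof (rule continuous_on_coordinatewise_then_product)
    fix i show "continuous_on (simplex_boundary g) (\<lambda>s. cone_point g m s i)"
      unfolding cone_point_def
      by (cases "i \<in> g") (auto intro!: continuous_on_add continuous_on_mult continuous_on_coordinate)
  qed
  have "cone_point g m \<in> simplex_boundary g \<rightarrow> std_simplex g"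
    using cone_point_in_simplex[OF fin ne] m bd by auto
  then have "openin (top_of_set (simplex_boundary g))
      (simplex_boundary g \<inter> cone_point g m -` (cone_ext g \<theta> ` C))"
    by (rule continuous_openin_preimage[OF cm _ op])
  moreover have "simplex_boundary g \<inter> cone_point g m -` (cone_ext g \<theta> ` C) = \<theta> ` ?St"
  proof
    show "simplex_boundary g \<inter> cone_point g m -` (cone_ext g \<theta> ` C) \<subseteq> \<theta> ` ?St"
    proof clarify
      fix s t assume s: "s \<in> simplex_boundary g" and t: "t \<in> C" and eq: "cone_point g m s = cone_ext g \<theta> t"
      have "s = cone_base g (cone_ext g \<theta> t)"
        using cone_base_cone_point[OF fin ne s m(2)] eq by simp
      also have "\<dots> = \<theta> (cone_base g t)"
        using cone_base_cone_ext[OF fin ne \<theta> _ hC[OF t]] t CD by auto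
      finally show "s \<in> \<theta> ` ?St" using bC[OF t] by blast
    qed
    show "\<theta> ` ?St \<subseteq> simplex_boundary g \<inter> cone_point g m -` (cone_ext g \<theta> ` C)"
    proof (rule image_subsetI)
      fix u assume u: "u \<in> ?St"
      then have ub: "u \<in> simplex_boundary g" by simp
      let ?t = "cone_point g m u"
      have mt: "Min (?t ` g) = m" by (rule Min_cone_point[OF fin ne ub m(3)])
      have tD: "?t \<in> std_simplex g" using cone_point_in_simplex[OF fin ne] m ub bd by auto
      then have "?t \<in> simplex_interior g" using Min_pos_iff[OF fin ne tD] mt m by simp
      moreover have "m < ?t i" if "i \<in> h" for i
        using u that m h by (auto simp: cone_point_def)
      ultimately have "?t \<in> C" using mt by (simp add: C_def)
      moreover have "cone_ext g \<theta> ?t = cone_point g m (\<theta> u)"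
        unfolding cone_ext_def mt cone_base_cone_point[OF fin ne ub m(2)] ..
      ultimately show "\<theta> u \<in> simplex_boundary g \<inter> cone_point g m -` (cone_ext g \<theta> ` C)"
        using \<theta> ub by (auto simp: image_iff intro!: bexI[of _ ?t])
    qed
  qed
  ultimately show ?thesis by simp
qed

lemma boundary_facet_star:
  assumes "finite g" "i \<in> g"
  shows "{t \<in> simplex_boundary g. \<forall>l\<in>g - {i}. 0 < t l} = simplex_interior (g - {i})"
proof
  show "{t \<in> simplex_boundary g. \<forall>l\<in>g - {i}. 0 < t l} \<subseteq> simplex_interior (g - {i})"
  proof clarify
    fix t assume t: "t \<in> simplex_boundary g" and pos: "\<forall>l\<in>g - {i}. 0 < t l"
    then obtain j where j: "j \<in> g" "t \<in> std_simplex (g - {j})"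
      using simplex_boundary_eq_facets[OF assms(1)] by blast
    then have "j = i" using pos std_simplex_zero[OF j(2), of j] by force
    then show "t \<in> simplex_interior (g - {i})" using j pos by (simp add: simplex_interior_def)
  qed
  show "simplex_interior (g - {i}) \<subseteq> {t \<in> simplex_boundary g. \<forall>l\<in>g - {i}. 0 < t l}"
    using assms simplex_boundary_eq_facets[OF assms(1)] by (auto simp: simplex_interior_def)
qed

text \<open>A pair of identified points one of which has maximal support forces, by openness of the image
  of the star of that support, an identification between the interiors of two facets.\<close>

lemma boundary_map_facet_overlap:
  assumes fin: "finite g"
    and cont: "continuous_on (simplex_boundary g) \<theta>" and \<theta>: "\<theta> ` simplex_boundary g \<subseteq> simplex_boundary g"
    and inj: "\<And>i. i \<in> g \<Longrightarrow> inj_on \<theta> (std_simplex (g - {i}))"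
    and not_inj: "\<not> inj_on \<theta> (simplex_boundary g)"
  obtains i j t t' where "i \<in> g" "j \<in> g" "i \<noteq> j" "t \<in> simplex_interior (g - {i})"
    "t' \<in> simplex_interior (g - {j})" "\<theta> t = \<theta> t'"
proof -
  define supp where "supp t = {i \<in> g. (0::real) < t i}" for t
  define Bad where "Bad p \<longleftrightarrow> fst p \<in> simplex_boundary g \<and> snd p \<in> simplex_boundary g \<and>
     fst p \<noteq> snd p \<and> \<theta> (fst p) = \<theta> (snd p)" for p
  obtain p0 where "Bad p0" using not_inj unfolding inj_on_def Bad_def by fastforce
  moreover have "\<forall>p. Bad p \<longrightarrow> card (supp (fst p)) < Suc (card g)"
    using fin by (auto simp: supp_def less_Suc_eq_le intro!: card_mono)
  ultimately obtain p where p: "Bad p" "\<And>q. Bad q \<Longrightarrow> card (supp (fst q)) \<le> card (supp (fst p))"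
    using ex_has_greatest_nat[of Bad p0 "\<lambda>p. card (supp (fst p))" "Suc (card g)"] by blast
  define t1 t2 where "t1 = fst p" and "t2 = snd p"
  have t: "t1 \<in> simplex_boundary g" "t2 \<in> simplex_boundary g" "t1 \<noteq> t2" "\<theta> t1 = \<theta> t2"
    using p(1) by (auto simp: Bad_def t1_def t2_def)
  have mx: "card (supp s) \<le> card (supp t1)"
    if "s \<in> simplex_boundary g" "s' \<in> simplex_boundary g" "s \<noteq> s'" "\<theta> s = \<theta> s'" for s s'
    using p(2)[of "(s, s')"] that by (simp add: Bad_def t1_def)
  let ?h = "supp t1"
  have finh: "finite ?h" "?h \<subseteq> g" using fin by (auto simp: supp_def)
  have D: "simplex_boundary g \<subseteq> std_simplex g" by (auto simp: simplex_boundary_def)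
  have supp0: "s i = 0" if "s \<in> simplex_boundary g" "i \<notin> supp s" "i \<in> g" for s i
  proof -
    have "s \<in> std_simplex g" using that(1) D by blast
    then have "0 \<le> s i" by (rule std_simplex_nonneg)
    moreover have "\<not> 0 < s i" using that by (simp add: supp_def)
    ultimately show ?thesis by simp
  qed
  have ne: "?h \<noteq> {}"
  proof
    assume "?h = {}"
    then have "t1 i = 0" if "i \<in> g" for i using supp0[OF t(1)] that by blast
    moreover have "sum t1 g = 1" using t D by (auto simp: std_simplex_def)
    ultimately show False by (simp cong: sum.cong)
  qed
  have samesupp: "s = s'" if s: "s \<in> simplex_boundary g" and s': "s' \<in> simplex_boundary g"
    and eq: "\<theta> s = \<theta> s'" and su: "supp s = supp s'" for s s'
  proof -
    have "s \<in> (\<Union>i\<in>g. std_simplex (g - {i}))"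
      using s simplex_boundary_eq_facets[OF fin] by simp
    then obtain i where i: "i \<in> g" "s \<in> std_simplex (g - {i})" by blast
    then have "i \<notin> supp s" using std_simplex_zero[OF i(2), of i] by (auto simp: supp_def)
    then have "s' i = 0" using supp0[OF s' _ i(1)] su by simp
    then have "s' \<in> std_simplex (g - {i})"
      using i(1) s' D std_simplex_face[OF fin, of s' "g - {i}"] by auto
    then show ?thesis using inj_onD[OF inj[OF i(1)], OF eq i(2)] by blast
  qed
  let ?St = "{t \<in> simplex_boundary g. \<forall>i\<in>?h. 0 < t i}"
  have star_supp: "?h \<subseteq> supp s" if "s \<in> ?St" for s using that by (auto simp: supp_def)
  \<comment> \<open>Distinct identified points of the star have supports containing
    \<open>?h\<close>, and by maximality these are no larger. So the supports coincide, the points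
    share a facet, and \<open>\<theta>\<close> is injective there.\<close>
  have "inj_on \<theta> ?St"
  proof (rule inj_onI, rule ccontr)
    fix s s' assume s: "s \<in> ?St" and s': "s' \<in> ?St" and eq: "\<theta> s = \<theta> s'" and neq: "s \<noteq> s'"
    have "card (supp s) \<le> card ?h" "card (supp s') \<le> card ?h"
      using mx[of s s'] mx[of s' s] s s' eq neq by auto
    moreover have "finite (supp s)" "finite (supp s')" using fin by (auto simp: supp_def)
    ultimately have "supp s = ?h" "supp s' = ?h"
      using card_seteq[OF _ star_supp[OF s]] card_seteq[OF _ star_supp[OF s']] by simp_all
    then show False using samesupp[of s s'] s s' eq neq by auto
  qed
  then have op: "openin (top_of_set (simplex_boundary g)) (\<theta> ` ?St)"
    by (rule openin_boundary_star_image[OF fin ne finh(2) cont \<theta>])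
  have "\<not> ?h \<subseteq> supp t2"
  proof
    assume h2: "?h \<subseteq> supp t2"
    have "card (supp t2) \<le> card ?h" using mx[of t2 t1] t by auto
    then have "supp t2 = ?h" using h2 card_seteq[of "supp t2" ?h] fin by (simp add: supp_def)
    then show False using samesupp[of t1 t2] t by simp
  qed
  then obtain j where j: "j \<in> ?h" "j \<notin> supp t2" by blast
  then have jg: "j \<in> g" by (simp add: supp_def)
  have "t2 j = 0" using supp0[OF t(2) j(2) jg] .
  then have t2j: "t2 \<in> std_simplex (g - {j})" using t(2) D std_simplex_face[OF fin, of t2 "g - {j}"] by auto
  \<comment> \<open>Openness allows \<open>t2\<close> to be moved into the interior of the facet
    omitting \<open>j\<close> while its image stays in the image of the star. The moved point has
    \<open>card g - 1\<close> positive coordinates, so maximality forces \<open>?h\<close> to be a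
    facet as well.\<close>
  have o1: "openin (top_of_set (simplex_boundary g)) (simplex_boundary g \<inter> \<theta> -` (\<theta> ` ?St))"
    by (rule continuous_openin_preimage[OF cont _ op]) (use \<theta> in auto)
  have m1: "t2 \<in> simplex_boundary g \<inter> \<theta> -` (\<theta> ` ?St)"
    using t by (auto simp: supp_def image_iff intro!: exI[of _ t1])
  have s1: "std_simplex (g - {j}) \<subseteq> simplex_boundary g"
    using jg simplex_boundary_eq_facets[OF fin] by blast
  obtain t' where "t' \<in> simplex_interior (g - {j})"
      "t' \<in> simplex_boundary g \<inter> \<theta> -` (\<theta> ` ?St)"
    using simplex_interior_dense[OF finite_Diff[OF fin] s1 o1 t2j m1] .
  then have t': "t' \<in> simplex_interior (g - {j})" "t' \<in> simplex_boundary g" "\<theta> t' \<in> \<theta> ` ?St"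
    by auto
  then obtain s where s: "s \<in> ?St" "\<theta> t' = \<theta> s" by blast
  have "t' j = 0" using t'(1) by (simp add: simplex_interior_def std_simplex_def)
  then have "t' \<noteq> s" using s j by auto
  moreover have "supp t' = g - {j}"
    using t'(1) \<open>t' j = 0\<close> by (auto simp: supp_def simplex_interior_def)
  ultimately have "card (g - {j}) \<le> card ?h" using mx[of t' s] t' s by auto
  have "s \<in> (\<Union>i\<in>g. std_simplex (g - {i}))"
    using s(1) simplex_boundary_eq_facets[OF fin] by simp
  then obtain i where i: "i \<in> g" "s \<in> std_simplex (g - {i})" by blast
  have "s i = 0" using std_simplex_zero[OF i(2), of i] by simp
  then have "supp s \<subseteq> g - {i}" by (auto simp: supp_def)
  then have sub: "?h \<subseteq> g - {i}" using star_supp[OF s(1)] by blast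
  moreover have "card (g - {i}) = card (g - {j})" using fin i jg by simp
  ultimately have "?h = g - {i}"
    using card_seteq[of "g - {i}" ?h] fin \<open>card (g - {j}) \<le> card ?h\<close> by auto
  then have "s \<in> simplex_interior (g - {i})"
    using s boundary_facet_star[OF fin i(1)] by auto
  moreover have "i \<noteq> j" using j sub by blast
  ultimately show thesis using that[OF i(1) jg _ _ t'(1)] s(2) by simp
qed

section \<open>Pareto sets of simple problems\<close>

lemma mfd_interior_homeomorphism_subset:
  assumes "homeomorphism S T e e'"
  shows "e ` mfd_interior d S \<subseteq> mfd_interior d T"
proof clarify
  fix p assume "p \<in> mfd_interior d S"
  then obtain U V where p: "p \<in> S" "p \<in> U" and U: "openin (top_of_set S) U"
    and V: "openin (top_of_set (Rsp d)) V" "U homeomorphic V"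
    unfolding mfd_interior_def by blast
  have "openin (top_of_set T) (e ` U)" by (rule homeomorphism_imp_open_map[OF assms U])
  moreover have "U homeomorphic e ` U"
    using homeomorphism_of_subsets[OF assms openin_imp_subset[OF U] _ refl]
      homeomorphism_image1[OF assms] openin_imp_subset[OF U]
    unfolding homeomorphic_def by blast
  then have "e ` U homeomorphic V" using V(2) homeomorphic_trans homeomorphic_sym by blast
  moreover have "e p \<in> T" using p homeomorphism_image1[OF assms] by blast
  ultimately show "e p \<in> mfd_interior d T"
    unfolding mfd_interior_def using p(2) V(1) by blast
qed

lemma mfd_interior_homeomorphism:
  assumes "homeomorphism S T e e'"
  shows "mfd_interior d T = e ` mfd_interior d S"
proof
  have "e' ` mfd_interior d T \<subseteq> mfd_interior d S"
    by (rule mfd_interior_homeomorphism_subset[OF homeomorphism_symD[OF assms]])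
  moreover have "mfd_interior d T \<subseteq> T" by (auto simp: mfd_interior_def)
  then have "e ` e' ` mfd_interior d T = mfd_interior d T"
    using homeomorphism_apply2[OF assms] by (force simp: image_iff)
  ultimately show "mfd_interior d T \<subseteq> e ` mfd_interior d S" by blast
qed (rule mfd_interior_homeomorphism_subset[OF assms])

section \<open>Dominance and dimension in simple problems\<close>

locale simple_multiobjective_problem =
  fixes F :: "'n::finite objective set" and X :: "(real^'n) set"
  assumes simple: "simple_problem F X"
begin

abbreviation "P g \<equiv> pareto_set X g"

text \<open>The truncated \<open>card g - 1\<close> is 0 for \<open>g = {}\<close>; this does no
  harm, as the Pareto set is then empty and so is its interior.\<close>

abbreviation "I g \<equiv> mfd_interior (card g - 1) (pareto_set X g)"

lemma finite_sub: "g \<subseteq> F \<Longrightarrow> finite g"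
  using simple by (auto simp: simple_problem_def intro: finite_subset)

lemma pareto_homeomorphism:
  assumes "g \<subseteq> F"
  obtains \<phi> \<psi> where "homeomorphism (P g) (std_simplex g) \<phi> \<psi>"
  using simple assms unfolding simple_problem_def homeomorphic_def by blast

lemma eval_map_homeomorphism:
  assumes "g \<subseteq> F"
  obtains e where "homeomorphism (P g) (eval_map g ` P g) (eval_map g) e"
proof -
  have "embedding_map (top_of_set (P g)) euclidean (eval_map g)"
    using simple assms unfolding simple_problem_def by blast
  then have "homeomorphic_map (top_of_set (P g)) (top_of_set (eval_map g ` P g)) (eval_map g)"
    by (simp add: embedding_map_def)
  then obtain e where "homeomorphic_maps (top_of_set (P g)) (top_of_set (eval_map g ` P g)) (eval_map g) e"
    unfolding homeomorphic_map_maps by blast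
  then show thesis using that by simp
qed

lemma continuous_objective:
  assumes "g \<subseteq> F" "f \<in> g"
  shows "continuous_on (P g) f"
proof -
  obtain e where "homeomorphism (P g) (eval_map g ` P g) (eval_map g) e"
    using eval_map_homeomorphism[OF assms(1)] .
  then have "continuous_on (P g) (eval_map g)" by (rule homeomorphism_cont1)
  then have "continuous_on (P g) (\<lambda>x. eval_map g x f)" by (rule continuous_on_product_then_coordinatewise)
  then show ?thesis using assms(2) by (simp add: eval_map_def)
qed

lemma pareto_subset: "P g \<subseteq> X"
  by (auto simp: pareto_set_def)

lemma pareto_nonempty: "x \<in> P g \<Longrightarrow> g \<noteq> {}"
  by (auto simp: pareto_set_def)

text \<open>A weakly dominating point has the same values as \<open>x\<close>, since
  \<open>x\<close> admits no strict improvement. It is therefore itself Pareto optimal for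
  \<open>g\<close>, and injectivity of \<open>eval_map g\<close> on the Pareto set, from (S2),
  identifies the two.\<close>

lemma pareto_le_imp_eq:
  assumes g: "g \<subseteq> F" and x: "x \<in> P g" and y: "y \<in> X" and le: "\<And>f. f \<in> g \<Longrightarrow> f y \<le> f x"
  shows "y = x"
proof -
  have ne: "g \<noteq> {}" using pareto_nonempty[OF x] .
  have px: "\<not> (\<exists>z\<in>X. (\<forall>f\<in>g. f z \<le> f x) \<and> (\<exists>f\<in>g. f z < f x))"
    using x ne by (simp add: pareto_set_def)
  have eq: "f y = f x" if "f \<in> g" for f using px y le that by (meson order_le_less)
  have same: "(\<forall>f\<in>g. f z \<le> f y) \<longleftrightarrow> (\<forall>f\<in>g. f z \<le> f x)" "(\<exists>f\<in>g. f z < f y) \<longleftrightarrow> (\<exists>f\<in>g. f z < f x)" for z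
    by (simp_all add: eq)
  have "\<not> (\<exists>z\<in>X. (\<forall>f\<in>g. f z \<le> f y) \<and> (\<exists>f\<in>g. f z < f y))" using px unfolding same .
  then have "y \<in> P g" using y ne by (simp add: pareto_set_def)
  moreover have "eval_map g y = eval_map g x" using eq by (auto simp: eval_map_def)
  moreover obtain e where e: "homeomorphism (P g) (eval_map g ` P g) (eval_map g) e"
    using eval_map_homeomorphism[OF g] .
  ultimately show ?thesis using x homeomorphism_apply1[OF e] by metis
qed

text \<open>In a general problem this inclusion can fail, as ties in \<open>h\<close> may be broken
  by further objectives. Here a point dominating \<open>x\<close> for \<open>g\<close> weakly
  dominates it for \<open>h\<close>, hence equals \<open>x\<close> and cannot improve
  strictly.\<close>

lemma pareto_mono:
  assumes g: "g \<subseteq> F" and hg: "h \<subseteq> g"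
  shows "P h \<subseteq> P g"
proof
  fix x assume x: "x \<in> P h"
  have "\<not> (\<exists>y\<in>X. (\<forall>f\<in>g. f y \<le> f x) \<and> (\<exists>f\<in>g. f y < f x))"
  proof clarify
    fix y f assume y: "y \<in> X" "\<forall>f\<in>g. f y \<le> f x" and f: "f \<in> g" "f y < f x"
    have "y = x" by (rule pareto_le_imp_eq[of h]) (use x y g hg in auto)
    then show False using f by simp
  qed
  then show "x \<in> P g" using pareto_nonempty[OF x] pareto_subset x hg by (auto simp: pareto_set_def)
qed

lemma pareto_interior_iff:
  assumes "g \<subseteq> F" "homeomorphism (P g) (std_simplex g) \<phi> \<psi>" "x \<in> P g"
  shows "x \<in> I g \<longleftrightarrow> \<phi> x \<in> simplex_interior g"
  using mfd_interior_simplex[OF finite_sub[OF assms(1)] pareto_nonempty[OF assms(3)] assms(2)] assms(3)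
  by simp

text \<open>The differences \<open>f - f0\<close> are injective on a Pareto set, so near a manifold interior point
  \<open>x\<close> they take all values: in particular those which improve on \<open>x\<close> relatively for the
  objectives in \<open>h\<close>.\<close>

lemma subproblem_not_interior:
  assumes g: "g \<subseteq> F" and hg: "h \<subset> g" and x: "x \<in> P h"
  shows "x \<notin> I g"
proof
  assume xI: "x \<in> I g"
  obtain \<phi> \<psi> where hom: "homeomorphism (P g) (std_simplex g) \<phi> \<psi>"
    using pareto_homeomorphism[OF g] .
  have xg: "x \<in> P g" using pareto_mono[OF g] hg x by blast
  have ne: "g \<noteq> {}" and neh: "h \<noteq> {}" using pareto_nonempty x xg by auto
  have fin: "finite g" using finite_sub[OF g] .
  have hF: "h \<subseteq> F" using g hg by blast
  have t0: "\<phi> x \<in> simplex_interior g" using pareto_interior_iff[OF g hom xg] xI by simp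
  obtain f0 where f0: "f0 \<in> g" using ne by blast
  let ?U = "simplex_interior g"
  have UD: "?U \<subseteq> std_simplex g" by (auto simp: simplex_interior_def)
  have \<psi>P: "\<psi> t \<in> P g" if "t \<in> ?U" for t
    using that UD homeomorphism_image2[OF hom] by blast
  \<comment> \<open>Subtracting the reference objective \<open>f0\<close> leaves
    \<open>card g - 1\<close> differences, which is the dimension of the simplex interior, as
    invariance of domain requires.\<close>
  define k where "k t = (\<lambda>f. if f \<in> g - {f0} then f (\<psi> t) - f0 (\<psi> t) else 0)" for t
  have "openin (top_of_set (coord_space (g - {f0}))) (k ` ?U)"
  proof (rule invariance_of_domain_simplex[OF fin ne _ _ simplex_interior_openin[OF fin] order_refl])
    have c\<psi>: "continuous_on ?U \<psi>" by (rule continuous_on_subset[OF homeomorphism_cont2[OF hom] UD])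
    have cf: "continuous_on ?U (\<lambda>t. f (\<psi> t))" if "f \<in> g" for f
      by (rule continuous_on_compose2[OF continuous_objective[OF g that] c\<psi>]) (use \<psi>P in blast)
    show "continuous_on ?U k"
    proof (rule continuous_on_coordinatewise_then_product)
      fix f show "continuous_on ?U (\<lambda>t. k t f)"
        using continuous_on_diff[OF cf cf[OF f0], of f] unfolding k_def by (cases "f \<in> g - {f0}") auto
    qed
    show "k ` ?U \<subseteq> coord_space (g - {f0})" by (auto simp: k_def coord_space_def)
    \<comment> \<open>Equal differences mean that all objectives change by the same amount, so one
      of the two points weakly dominates the other.\<close>
    show "inj_on k ?U"
    proof (rule inj_onI)
      fix s t assume s: "s \<in> ?U" and t: "t \<in> ?U" and eq: "k s = k t"
      have d: "f (\<psi> s) - f (\<psi> t) = f0 (\<psi> s) - f0 (\<psi> t)" if "f \<in> g" for f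
        using fun_cong[OF eq, of f] that by (cases "f = f0") (auto simp: k_def)
      have "\<psi> s = \<psi> t"
      proof (cases "f0 (\<psi> s) \<le> f0 (\<psi> t)")
        case True
        have "f (\<psi> s) \<le> f (\<psi> t)" if "f \<in> g" for f using d[OF that] True by linarith
        then show ?thesis using pareto_le_imp_eq[OF g \<psi>P[OF t]] \<psi>P[OF s] pareto_subset by blast
      next
        case False
        have "f (\<psi> t) \<le> f (\<psi> s)" if "f \<in> g" for f using d[OF that] False by linarith
        then have "\<psi> t = \<psi> s" using pareto_le_imp_eq[OF g \<psi>P[OF s]] \<psi>P[OF t] pareto_subset by blast
        then show ?thesis by simp
      qed
      then show "s = t" using homeomorphism_apply2[OF hom] s t UD by (metis subsetD)
    qed
  qed (use fin f0 in auto)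
  note W = this
  \<comment> \<open>A direction in which the objectives outside \<open>h\<close> increase relative
    to those in \<open>h\<close>. Differences determine the values only up to a common shift, which
    is the number \<open>s\<close> below.\<close>
  define d where "d f = (if f \<in> h then 0 else 1 :: real)" for f
  define c where "c e = (\<lambda>f. if f \<in> g - {f0} then f x - f0 x + e * (d f - d f0) else 0)" for e :: real
  have "continuous_on {0..1} c"
  proof (rule continuous_on_coordinatewise_then_product)
    fix f show "continuous_on {0..1} (\<lambda>e. c e f)"
      unfolding c_def by (cases "f \<in> g - {f0}") (auto intro!: continuous_intros)
  qed
  moreover have "c ` {0..1} \<subseteq> coord_space (g - {f0})" by (auto simp: c_def coord_space_def)
  moreover have "c 0 = k (\<phi> x)" using homeomorphism_apply1[OF hom xg] by (auto simp: c_def k_def)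
  then have "c 0 \<in> k ` ?U" using t0 by blast
  ultimately obtain e where e: "0 < e" "c e \<in> k ` ?U"
    using openin_contains_curve[OF W _ zero_less_one] by blast
  then obtain t where t: "t \<in> ?U" "c e = k t" by blast
  define q where "q = \<psi> t"
  have q: "q \<in> P g" "q \<in> X" using \<psi>P[OF t(1)] pareto_subset by (auto simp: q_def)
  define s where "s = f0 q - f0 x - e * d f0"
  have fq: "f q = f x + e * d f + s" if "f \<in> g" for f
    using fun_cong[OF t(2), of f] that
    by (cases "f = f0") (auto simp: c_def k_def q_def s_def algebra_simps)
  have xX: "x \<in> X" using xg pareto_subset by blast
  \<comment> \<open>For \<open>0 \<le> s\<close> the point \<open>x\<close> weakly dominates
    \<open>q\<close> and is strictly better outside \<open>h\<close>; for \<open>s < 0\<close> the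
    point \<open>q\<close> improves on \<open>x\<close> in every objective of \<open>h\<close>.
    Either way optimality is contradicted.\<close>
  show False
  proof (cases "0 \<le> s")
    case True
    have "f x \<le> f q" if "f \<in> g" for f using fq[OF that] True e by (simp add: d_def)
    then have "x = q" using pareto_le_imp_eq[OF g q(1) xX] by blast
    moreover obtain f where "f \<in> g" "f \<notin> h" using hg by blast
    ultimately show False using fq[of f] True e by (simp add: d_def)
  next
    case False
    have lt: "f q < f x" if "f \<in> h" for f using fq[of f] that hg False by (auto simp: d_def)
    then have "q = x" using pareto_le_imp_eq[OF hF x q(2)] by (meson less_imp_le)
    then show False using lt neh by blast
  qed
qed

text \<open>A simplex embedded in \<open>real^'n\<close> has dimension at most
  \<open>CARD('n)\<close>, by invariance of domain. The bound makes \<open>'n option\<close>, with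
  its \<open>CARD('n) + 1\<close> elements, a sufficient index type for the fixed point theorem
  behind \<open>kkm_open\<close>.\<close>

lemma card_subproblem_le:
  assumes g: "g \<subseteq> F" "g \<noteq> {}"
  shows "card g \<le> CARD('n option)"
proof (rule ccontr)
  assume big: "\<not> card g \<le> CARD('n option)"
  obtain \<phi> \<psi> where hom: "homeomorphism (P g) (std_simplex g) \<phi> \<psi>"
    using pareto_homeomorphism[OF g(1)] .
  have fin: "finite g" using finite_sub[OF g(1)] .
  obtain f0 where f0: "f0 \<in> g" using g by blast
  let ?L = "g - {f0}" and ?U = "simplex_interior g"
  have "CARD('n) < card ?L" using big fin f0 by simp
  then obtain e :: "'n \<Rightarrow> 'n objective" where e: "inj e" "range e \<subseteq> ?L"
    using card_le_inj[of "UNIV :: 'n set" ?L] fin by (metis finite_Diff finite_class.finite_UNIV less_imp_le)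
  have "card (range e) = CARD('n)" by (rule card_image[OF e(1)])
  then have "range e \<noteq> ?L" using \<open>CARD('n) < card ?L\<close> by force
  \<comment> \<open>A coordinate not hit by \<open>e\<close>: the image of \<open>k\<close> vanishes
    there, so it cannot be open in \<open>coord_space ?L\<close>.\<close>
  then obtain f1 where f1: "f1 \<in> ?L" "f1 \<notin> range e" using e by blast
  have UD: "?U \<subseteq> std_simplex g" by (auto simp: simplex_interior_def)
  define k where "k t = (\<lambda>f. if f \<in> range e then \<psi> t $ inv_into UNIV e f else 0)" for t
  have kz: "k t f = 0" if "f \<notin> ?L" for t f
  proof -
    have "f \<notin> range e" using that e(2) by blast
    then show ?thesis by (simp only: k_def if_False)
  qed
  have W: "openin (top_of_set (coord_space ?L)) (k ` ?U)"
  proof (rule invariance_of_domain_simplex[OF fin g(2) _ _ simplex_interior_openin[OF fin] order_refl])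
    have c\<psi>: "continuous_on ?U \<psi>" by (rule continuous_on_subset[OF homeomorphism_cont2[OF hom] UD])
    show "continuous_on ?U k"
    proof (rule continuous_on_coordinatewise_then_product)
      fix f show "continuous_on ?U (\<lambda>t. k t f)"
        unfolding k_def by (cases "f \<in> range e") (auto intro!: continuous_intros c\<psi>)
    qed
    show "k ` ?U \<subseteq> coord_space ?L" using kz by (auto simp: coord_space_def)
    show "inj_on k ?U"
    proof (rule inj_onI)
      fix s t assume s: "s \<in> ?U" and t: "t \<in> ?U" and eq: "k s = k t"
      have "\<psi> s $ a = \<psi> t $ a" for a
        using fun_cong[OF eq, of "e a"] e(1) by (simp add: k_def)
      then have "\<psi> s = \<psi> t" by (simp add: vec_eq_iff)
      then show "s = t" using homeomorphism_apply2[OF hom] s t UD by (metis subsetD)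
    qed
  qed (use fin f0 in auto)
  have "(\<lambda>f. if f = f0 then 1 else 0) \<in> std_simplex g"
    using f0 fin by (auto simp: mem_std_simplex)
  then obtain t where t: "t \<in> ?U"
    using simplex_interior_dense[OF fin order_refl openin_subtopology_self] by blast
  define c where "c r = (k t)(f1 := r)" for r :: real
  have "continuous_on {0..1} c" unfolding c_def[abs_def] by (intro continuous_on_fun_upd continuous_intros)
  moreover have "c ` {0..1} \<subseteq> coord_space ?L" using kz f1 by (auto simp: c_def coord_space_def)
  moreover have "c 0 = k t" using f1 by (auto simp: c_def k_def)
  then have "c 0 \<in> k ` ?U" using t by blast
  ultimately obtain r where r: "0 < r" "c r \<in> k ` ?U"
    using openin_contains_curve[OF W _ zero_less_one] by blast
  then obtain s where "c r = k s" by blast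
  then have "c r f1 = k s f1" by simp
  then show False using r f1 by (simp add: c_def k_def)
qed

section \<open>Parametrised faces and the induction on subproblems\<close>

definition faces_cover :: "'n objective set \<Rightarrow> bool" where
  "faces_cover g \<longleftrightarrow> (\<forall>x \<in> P g. x \<notin> I g \<longrightarrow> (\<exists>h. h \<subset> g \<and> x \<in> P h))"

definition faces_meet :: "'n objective set \<Rightarrow> bool" where
  "faces_meet g \<longleftrightarrow> (\<forall>h1 h2. h1 \<subseteq> g \<longrightarrow> h2 \<subseteq> g \<longrightarrow> P h1 \<inter> P h2 \<subseteq> P (h1 \<inter> h2))"

text \<open>Proper faces avoid the manifold interior by \<open>subproblem_not_interior\<close>, so
  in simplex coordinates the parametrisation becomes a self-map of the boundary, as the cone lemmas
  require.\<close>

lemma boundary_image_pareto: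
  assumes h: "h \<subseteq> F" and hom: "homeomorphism (P h) (std_simplex h) \<phi> \<psi>"
    and \<sigma>: "\<And>h'. h' \<subset> h \<Longrightarrow> \<sigma> ` std_simplex h' = P h'"
  shows "(\<phi> \<circ> \<sigma>) ` simplex_boundary h \<subseteq> simplex_boundary h"
    and "t \<in> simplex_boundary h \<Longrightarrow> \<sigma> t \<in> P h"
proof -
  have fin: "finite h" using finite_sub[OF h] .
  have *: "\<sigma> t \<in> P h \<and> \<phi> (\<sigma> t) \<in> simplex_boundary h" if "t \<in> simplex_boundary h" for t
  proof -
    have "t \<in> (\<Union>i\<in>h. std_simplex (h - {i}))" using that simplex_boundary_eq_facets[OF fin] by simp
    then obtain i where i: "i \<in> h" "t \<in> std_simplex (h - {i})" by blast
    then have psub: "h - {i} \<subset> h" by blast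
    then have \<sigma>t: "\<sigma> t \<in> P (h - {i})" using \<sigma> i by blast
    then have Ph: "\<sigma> t \<in> P h" using pareto_mono[OF h, of "h - {i}"] by blast
    have "\<sigma> t \<notin> I h" by (rule subproblem_not_interior[OF h psub \<sigma>t])
    then have "\<phi> (\<sigma> t) \<notin> simplex_interior h" using pareto_interior_iff[OF h hom Ph] by simp
    moreover have "\<phi> (\<sigma> t) \<in> std_simplex h" using Ph homeomorphism_image1[OF hom] by blast
    ultimately show ?thesis using Ph by (simp add: simplex_boundary_def)
  qed
  show "(\<phi> \<circ> \<sigma>) ` simplex_boundary h \<subseteq> simplex_boundary h" using * by auto
  show "t \<in> simplex_boundary h \<Longrightarrow> \<sigma> t \<in> P h" using * by auto
qed

text \<open>The family \<open>K\<close> is an abstract simplicial complex of subproblems; the proper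
  subsets of some \<open>g\<close> are the case of interest, and the general form carries the
  induction. A member \<open>h\<close> of maximal size is removed. On the boundary of its simplex
  \<open>\<phi> \<circ> \<sigma>\<close> is a bijection, onto by \<open>faces_cover\<close> and
  one-to-one by \<open>faces_meet\<close>, so it can be coned off.\<close>

lemma cell_complex_parametrization:
  assumes "finite K" "\<And>h. h \<in> K \<Longrightarrow> h \<subseteq> F" "\<And>h h'. h \<in> K \<Longrightarrow> h' \<subseteq> h \<Longrightarrow> h' \<in> K"
    and "\<And>h. h \<in> K \<Longrightarrow> faces_cover h" "\<And>h. h \<in> K \<Longrightarrow> faces_meet h"
  shows "\<exists>\<sigma>. continuous_on (\<Union>h\<in>K. std_simplex h) \<sigma> \<and>
           (\<forall>h\<in>K. inj_on \<sigma> (std_simplex h) \<and> \<sigma> ` std_simplex h = P h)"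
  using assms
proof (induction K rule: finite_psubset_induct)
  case (psubset K)
  note KF = psubset.prems(1) and down = psubset.prems(2) and cover = psubset.prems(3) and meet = psubset.prems(4)
  show ?case
  proof (cases "K = {}")
    case True then show ?thesis by simp
  next
    case False
    have "Max (card ` K) \<in> card ` K" using psubset.hyps False by (intro Max_in) auto
    then obtain h where h: "h \<in> K" "card h = Max (card ` K)" by auto
    have mx: "card h' \<le> card h" if "h' \<in> K" for h'
      unfolding h(2) using psubset.hyps that by (intro Max_ge) auto
    have hF: "h \<subseteq> F" and fin: "finite h" using KF h finite_sub by auto
    define K' where "K' = K - {h}"
    \<comment> \<open>By maximality no other member contains \<open>h\<close>; hence
      \<open>K'\<close> is still closed under subsets.\<close>
    have nsub: "\<not> h \<subseteq> h'" if "h' \<in> K'" for h'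
    proof
      assume "h \<subseteq> h'"
      moreover have "h' \<in> K" "h' \<noteq> h" using that by (auto simp: K'_def)
      moreover have "finite h'" using KF finite_sub \<open>h' \<in> K\<close> by blast
      ultimately show False using mx[of h'] card_seteq[of h' h] by blast
    qed
    have down': "h'' \<in> K'" if "h' \<in> K'" "h'' \<subseteq> h'" for h' h''
      using that nsub[of h'] down[of h' h''] by (auto simp: K'_def)
    have "K' \<subset> K" using h by (auto simp: K'_def)
    then have "\<exists>\<sigma>. continuous_on (\<Union>h\<in>K'. std_simplex h) \<sigma> \<and>
           (\<forall>h\<in>K'. inj_on \<sigma> (std_simplex h) \<and> \<sigma> ` std_simplex h = P h)"
    proof (rule psubset.IH)
      fix h' assume h': "h' \<in> K'"
      then have "h' \<in> K" by (simp add: K'_def)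
      then show "h' \<subseteq> F" "faces_cover h'" "faces_meet h'" by (fact KF cover meet)+
      show "h'' \<in> K'" if "h'' \<subseteq> h'" for h'' by (rule down'[OF h' that])
    qed
    then obtain \<sigma> where c\<sigma>: "continuous_on (\<Union>h\<in>K'. std_simplex h) \<sigma>"
      and i\<sigma>: "\<And>h. h \<in> K' \<Longrightarrow> inj_on \<sigma> (std_simplex h)"
      and s\<sigma>: "\<And>h. h \<in> K' \<Longrightarrow> \<sigma> ` std_simplex h = P h" by blast
    have K: "K = insert h K'" using h by (auto simp: K'_def)
    show ?thesis
    proof (cases "h = {}")
      case True
      then have "std_simplex h = {}" "P h = {}" by (auto simp: std_simplex_def pareto_set_def)
      then show ?thesis unfolding K using c\<sigma> i\<sigma> s\<sigma> by (intro exI[of _ \<sigma>]) auto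
    next
      case ne: False
      obtain \<phi> \<psi> where hom: "homeomorphism (P h) (std_simplex h) \<phi> \<psi>"
        using pareto_homeomorphism[OF hF] .
      have face: "h' \<in> K'" if "h' \<subset> h" for h' using that down[OF h(1), of h'] by (auto simp: K'_def)
      have sface: "\<sigma> ` std_simplex h' = P h'" if "h' \<subset> h" for h' using s\<sigma> face that by blast
      define \<beta> where "\<beta> = \<phi> \<circ> \<sigma>"
      have bsub: "\<beta> ` simplex_boundary h \<subseteq> simplex_boundary h"
        unfolding \<beta>_def using boundary_image_pareto(1)[OF hF hom sface] by blast
      have \<sigma>P: "\<sigma> t \<in> P h" if "t \<in> simplex_boundary h" for t
        using boundary_image_pareto(2)[OF hF hom sface that] by blast
      have bdK: "simplex_boundary h \<subseteq> (\<Union>h\<in>K'. std_simplex h)"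
      proof -
        have "h - {i} \<in> K'" if "i \<in> h" for i using that by (intro face) blast
        then show ?thesis unfolding simplex_boundary_eq_facets[OF fin] by blast
      qed
      have Kbd: "t \<in> simplex_boundary h" if "t \<in> std_simplex h" "t \<in> std_simplex h'" "h' \<in> K'" for t h'
      proof -
        have "finite h'" using that KF finite_sub by (auto simp: K'_def)
        then have "t \<in> std_simplex (h \<inter> h')" using that std_simplex_Int[OF fin] by blast
        moreover have "h \<inter> h' \<subset> h" using nsub[OF that(3)] by blast
        ultimately show ?thesis using std_simplex_proper_face_boundary[OF fin] by blast
      qed
      have bsup: "simplex_boundary h \<subseteq> \<beta> ` simplex_boundary h"
      proof
        fix s assume s: "s \<in> simplex_boundary h"
        then have sD: "s \<in> std_simplex h" by (simp add: simplex_boundary_def)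
        have x: "\<psi> s \<in> P h" "\<phi> (\<psi> s) = s"
          using sD homeomorphism_image2[OF hom] homeomorphism_apply2[OF hom] by auto
        then have "\<psi> s \<notin> I h"
          using pareto_interior_iff[OF hF hom x(1)] s by (simp add: simplex_boundary_def)
        then obtain h' where h': "h' \<subset> h" "\<psi> s \<in> P h'"
          using cover[OF h(1)] x(1) unfolding faces_cover_def by blast
        then obtain t where t: "t \<in> std_simplex h'" "\<sigma> t = \<psi> s" using sface[OF h'(1)] by (metis imageE)
        then have "\<beta> t = s" using x(2) by (simp add: \<beta>_def)
        moreover have "t \<in> simplex_boundary h" using t h' std_simplex_proper_face_boundary[OF fin] by blast
        ultimately show "s \<in> \<beta> ` simplex_boundary h" by blast
      qed
      have "inj_on \<sigma> (simplex_boundary h)"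
      proof (rule inj_onI)
        fix s t assume s: "s \<in> simplex_boundary h" and t: "t \<in> simplex_boundary h" and eq: "\<sigma> s = \<sigma> t"
        obtain i j where i: "i \<in> h" "s \<in> std_simplex (h - {i})" and j: "j \<in> h" "t \<in> std_simplex (h - {j})"
          using s t unfolding simplex_boundary_eq_facets[OF fin] by blast
        let ?hi = "h - {i}" and ?hj = "h - {j}"
        have sub: "?hi \<subset> h" "?hj \<subset> h" "?hi \<inter> ?hj \<subset> h" using i j by auto
        have "\<sigma> s \<in> P ?hi" using imageI[OF i(2), of \<sigma>] unfolding sface[OF sub(1)] .
        moreover have "\<sigma> s \<in> P ?hj" using imageI[OF j(2), of \<sigma>] unfolding sface[OF sub(2)] eq .
        ultimately have "\<sigma> s \<in> P (?hi \<inter> ?hj)"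
          using meet[OF h(1)] sub unfolding faces_meet_def by blast
        then have "\<sigma> s \<in> \<sigma> ` std_simplex (?hi \<inter> ?hj)" using sface[OF sub(3)] by simp
        then obtain u where u: "u \<in> std_simplex (?hi \<inter> ?hj)" "\<sigma> s = \<sigma> u" by blast
        then have uij: "u \<in> std_simplex ?hi" "u \<in> std_simplex ?hj"
          using std_simplex_Int[of ?hi ?hj] fin by auto
        have "s = u" using inj_onD[OF i\<sigma>[OF face[OF sub(1)]], OF u(2) i(2) uij(1)] .
        moreover have "t = u"
          using inj_onD[OF i\<sigma>[OF face[OF sub(2)]], of t u] u(2) eq j(2) uij(2) by simp
        ultimately show "s = t" by simp
      qed
      moreover have "inj_on \<phi> (\<sigma> ` simplex_boundary h)"
      proof (rule inj_on_subset)
        show "inj_on \<phi> (P h)" by (rule inj_on_inverseI[of _ \<psi>]) (rule homeomorphism_apply1[OF hom])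
      qed (use \<sigma>P in blast)
      ultimately have bi: "inj_on \<beta> (simplex_boundary h)" unfolding \<beta>_def by (rule comp_inj_on)
      have cb: "continuous_on (simplex_boundary h) \<beta>"
        unfolding \<beta>_def
        by (intro continuous_on_compose continuous_on_subset[OF c\<sigma> bdK] continuous_on_subset[OF homeomorphism_cont1[OF hom]])
           (use \<sigma>P in blast)
      have bD: "\<beta> ` simplex_boundary h \<subseteq> std_simplex h" using bsub by (auto simp: simplex_boundary_def)
      \<comment> \<open>The map \<open>\<psi>\<close> alone need not agree with
        \<open>\<sigma>\<close> on the boundary; precomposed with the continuous bijection
        \<open>E\<close> it does, and the other simplexes meet this one only there.\<close>
      define E where "E = cone_ext h \<beta>"
      have ED: "E ` std_simplex h = std_simplex h"
        unfolding E_def using cone_ext_surj[OF fin ne] bsub bsup by blast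
      have Ei: "inj_on E (std_simplex h)" unfolding E_def by (rule inj_on_cone_ext[OF fin ne bsub bi])
      have Ec: "continuous_on (std_simplex h) E" unfolding E_def by (rule continuous_on_cone_ext[OF fin ne cb bD])
      have Eb: "\<psi> (E t) = \<sigma> t" if "t \<in> simplex_boundary h" for t
      proof -
        have "E t = \<phi> (\<sigma> t)" unfolding E_def using cone_ext_boundary[OF fin ne that, of \<beta>] bD that by (auto simp: \<beta>_def)
        then show ?thesis using homeomorphism_apply1[OF hom \<sigma>P[OF that]] by simp
      qed
      define \<tau> where "\<tau> t = (if t \<in> std_simplex h then \<psi> (E t) else \<sigma> t)" for t
      have \<tau>K: "\<tau> t = \<sigma> t" if "t \<in> std_simplex h'" "h' \<in> K'" for t h'
        using Eb[OF Kbd[OF _ that]] by (simp add: \<tau>_def)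
      have "continuous_on (std_simplex h \<union> (\<Union>h\<in>K'. std_simplex h)) \<tau>"
        unfolding \<tau>_def
      proof (rule continuous_on_cases)
        show "closed (std_simplex h)" by (rule closed_std_simplex[OF fin])
        show "closed (\<Union>h\<in>K'. std_simplex h)"
          using psubset.hyps finite_sub[OF KF] by (intro closed_UN ballI closed_std_simplex) (auto simp: K'_def)
        show "continuous_on (std_simplex h) (\<lambda>t. \<psi> (E t))"
          by (rule continuous_on_compose2[OF homeomorphism_cont2[OF hom] Ec]) (use ED in blast)
        show "\<forall>t. t \<in> std_simplex h \<and> t \<notin> std_simplex h \<or> t \<in> (\<Union>h\<in>K'. std_simplex h) \<and> t \<in> std_simplex h
           \<longrightarrow> \<psi> (E t) = \<sigma> t" using Eb Kbd by blast
      qed (rule c\<sigma>)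
      then have 1: "continuous_on (\<Union>h\<in>K. std_simplex h) \<tau>" unfolding K by simp
      have inj\<psi>: "inj_on \<psi> (std_simplex h)"
        by (rule inj_on_inverseI[of _ \<phi>]) (rule homeomorphism_apply2[OF hom])
      have \<tau>h: "inj_on \<tau> (std_simplex h)" "\<tau> ` std_simplex h = P h"
      proof -
        have "inj_on (\<psi> \<circ> E) (std_simplex h)" using comp_inj_on[OF Ei] inj\<psi> ED by simp
        then show "inj_on \<tau> (std_simplex h)" by (simp add: \<tau>_def inj_on_def)
        have "\<tau> ` std_simplex h = \<psi> ` E ` std_simplex h" by (auto simp: \<tau>_def image_image)
        then show "\<tau> ` std_simplex h = P h" using ED homeomorphism_image2[OF hom] by simp
      qed
      have "inj_on \<tau> (std_simplex h') \<and> \<tau> ` std_simplex h' = P h'" if "h' \<in> K'" for h'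
      proof
        show "inj_on \<tau> (std_simplex h')"
          using i\<sigma>[OF that] \<tau>K[OF _ that] by (simp add: inj_on_def)
        have "\<tau> ` std_simplex h' = \<sigma> ` std_simplex h'" by (rule image_cong[OF refl \<tau>K[OF _ that]])
        then show "\<tau> ` std_simplex h' = P h'" using s\<sigma>[OF that] by simp
      qed
      then show ?thesis using 1 \<tau>h unfolding K by blast
    qed
  qed
qed


lemma parametrize_faces:
  assumes g: "g \<subseteq> F" and IH: "\<And>h. h \<subset> g \<Longrightarrow> faces_cover h \<and> faces_meet h"
  obtains \<sigma> where "continuous_on (simplex_boundary g) \<sigma>"
    "\<And>h. h \<subset> g \<Longrightarrow> inj_on \<sigma> (std_simplex h)" "\<And>h. h \<subset> g \<Longrightarrow> \<sigma> ` std_simplex h = P h"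
proof -
  have fin: "finite g" using finite_sub[OF g] .
  have "\<exists>\<sigma>. continuous_on (\<Union>h\<in>{h. h \<subset> g}. std_simplex h) \<sigma> \<and>
           (\<forall>h\<in>{h. h \<subset> g}. inj_on \<sigma> (std_simplex h) \<and> \<sigma> ` std_simplex h = P h)"
  proof (rule cell_complex_parametrization)
    show "finite {h. h \<subset> g}" by (rule finite_subset[of _ "Pow g"]) (use fin in auto)
  qed (use g IH in auto)
  then obtain \<sigma> where c: "continuous_on (\<Union>h\<in>{h. h \<subset> g}. std_simplex h) \<sigma>"
    and i: "\<And>h. h \<subset> g \<Longrightarrow> inj_on \<sigma> (std_simplex h) \<and> \<sigma> ` std_simplex h = P h" by blast
  have "simplex_boundary g \<subseteq> (\<Union>h\<in>{h. h \<subset> g}. std_simplex h)"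
    unfolding simplex_boundary_eq_facets[OF fin] by blast
  then show thesis using that[of \<sigma>] i continuous_on_subset[OF c] by blast
qed

text \<open>If \<open>x\<close> lay on the manifold boundary but on no face, coning off the parametrisation of the
  faces would give a map of the simplex missing \<open>x\<close>, to which the KKM lemma applies.\<close>

lemma faces_cover_step:
  assumes g: "g \<subseteq> F" and hom: "homeomorphism (P g) (std_simplex g) \<phi> \<psi>"
    and c\<sigma>: "continuous_on (simplex_boundary g) \<sigma>" and s\<sigma>: "\<And>h. h \<subset> g \<Longrightarrow> \<sigma> ` std_simplex h = P h"
  shows "faces_cover g"
  unfolding faces_cover_def
proof (intro ballI impI, rule ccontr)
  fix x assume x: "x \<in> P g" "x \<notin> I g" and no: "\<not> (\<exists>h. h \<subset> g \<and> x \<in> P h)"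
  have fin: "finite g" and ne: "g \<noteq> {}" using finite_sub[OF g] pareto_nonempty[OF x(1)] .
  have xX: "x \<in> X" using x(1) pareto_subset by blast
  have x\<phi>: "\<phi> x \<notin> simplex_interior g" using pareto_interior_iff[OF g hom x(1)] x(2) by simp
  define \<theta> where "\<theta> = \<phi> \<circ> \<sigma>"
  have \<theta>bd: "\<theta> ` simplex_boundary g \<subseteq> simplex_boundary g"
    unfolding \<theta>_def using boundary_image_pareto(1)[OF g hom s\<sigma>] by blast
  have \<sigma>P: "\<sigma> t \<in> P g" if "t \<in> simplex_boundary g" for t
    using boundary_image_pareto(2)[OF g hom s\<sigma> that] by blast
  have \<theta>D: "\<theta> ` simplex_boundary g \<subseteq> std_simplex g" using \<theta>bd by (auto simp: simplex_boundary_def)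
  have c\<theta>: "continuous_on (simplex_boundary g) \<theta>"
    unfolding \<theta>_def
    by (intro continuous_on_compose c\<sigma> continuous_on_subset[OF homeomorphism_cont1[OF hom]])
       (use \<sigma>P in blast)
  define \<tau> where "\<tau> t = \<psi> (cone_ext g \<theta> t)" for t
  have ED: "cone_ext g \<theta> t \<in> std_simplex g" if "t \<in> std_simplex g" for t
    by (rule cone_ext_in_simplex[OF fin ne \<theta>D that])
  have c\<tau>: "continuous_on (std_simplex g) \<tau>"
    unfolding \<tau>_def
    by (rule continuous_on_compose2[OF homeomorphism_cont2[OF hom] continuous_on_cone_ext[OF fin ne c\<theta> \<theta>D]])
       (use ED in blast)
  have \<tau>P: "\<tau> t \<in> P g" if "t \<in> std_simplex g" for t
    using ED[OF that] homeomorphism_image2[OF hom] unfolding \<tau>_def by blast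
  have \<tau>\<sigma>: "\<tau> t = \<sigma> t" if "t \<in> simplex_boundary g" for t
  proof -
    have "\<theta> t \<in> std_simplex g" using \<theta>D that by blast
    then have "\<tau> t = \<psi> (\<phi> (\<sigma> t))"
      using cone_ext_boundary[OF fin ne that, of \<theta>] by (simp add: \<tau>_def \<theta>_def)
    then show ?thesis using homeomorphism_apply1[OF hom \<sigma>P[OF that]] by simp
  qed
  have face: "\<tau> t \<in> P h" if "t \<in> std_simplex h" "h \<subseteq> g" for t h
  proof (cases "h = g")
    case True then show ?thesis using \<tau>P that by simp
  next
    case False
    then have hg: "h \<subset> g" using that by blast
    then have "t \<in> simplex_boundary g" using std_simplex_proper_face_boundary[OF fin hg] that by blast
    then have "\<tau> t = \<sigma> t" by (rule \<tau>\<sigma>)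
    then show ?thesis using s\<sigma>[OF hg] that(1) by blast
  qed
  \<comment> \<open>Interior points stay interior under the cone extension, while
    \<open>\<phi> x\<close> is not interior; boundary points go into facets, which avoid
    \<open>x\<close>.\<close>
  have \<tau>x: "\<tau> t \<noteq> x" if t: "t \<in> std_simplex g" for t
  proof (cases "t \<in> simplex_interior g")
    case True
    then have "cone_ext g \<theta> t \<in> simplex_interior g" by (rule cone_ext_interior[OF fin ne \<theta>D])
    moreover have "\<phi> (\<tau> t) = cone_ext g \<theta> t"
      unfolding \<tau>_def by (rule homeomorphism_apply2[OF hom ED[OF t]])
    ultimately show ?thesis using x\<phi> by auto
  next
    case False
    then have "t \<in> simplex_boundary g" using t by (simp add: simplex_boundary_def)
    then have "t \<in> (\<Union>i\<in>g. std_simplex (g - {i}))" by (simp add: simplex_boundary_eq_facets[OF fin])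
    then obtain i where i: "i \<in> g" "t \<in> std_simplex (g - {i})" by blast
    then have "\<tau> t \<in> P (g - {i})" using face by blast
    moreover have "g - {i} \<subset> g" using i by blast
    ultimately show ?thesis using no by blast
  qed
  \<comment> \<open>The KKM condition. If it failed at \<open>t\<close>, then \<open>x\<close> would
    weakly dominate \<open>\<tau> t\<close> for the objectives in the support of \<open>t\<close>,
    for which \<open>\<tau> t\<close> is Pareto optimal.\<close>
  have ex: "\<exists>f\<in>g. 0 < t f \<and> f (\<tau> t) - f x < 0" if t: "t \<in> std_simplex g" for t
  proof (rule ccontr)
    assume neg: "\<not> (\<exists>f\<in>g. 0 < t f \<and> f (\<tau> t) - f x < 0)"
    define h where "h = {f \<in> g. 0 < t f}"
    have hg: "h \<subseteq> g" by (auto simp: h_def)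
    have "t f = 0" if "f \<in> g" "f \<notin> h" for f
      using that std_simplex_nonneg[OF t, of f] by (simp add: h_def)
    then have th: "t \<in> std_simplex h" using std_simplex_face[OF fin t hg] by blast
    have "x = \<tau> t"
    proof (rule pareto_le_imp_eq[OF _ face[OF th hg] xX])
      show "h \<subseteq> F" using hg g by blast
      show "f x \<le> f (\<tau> t)" if "f \<in> h" for f using neg that by (force simp: h_def)
    qed
    then show False using \<tau>x[OF t] by simp
  qed
  have cf: "continuous_on (std_simplex g) (\<lambda>t. f (\<tau> t) - f x)" if "f \<in> g" for f
  proof -
    have "continuous_on (std_simplex g) (\<lambda>t. f (\<tau> t))"
      by (rule continuous_on_compose2[OF continuous_objective[OF g that] c\<tau>]) (use \<tau>P in blast)
    then show ?thesis by (intro continuous_on_diff continuous_on_const)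
  qed
  obtain t where t: "t \<in> std_simplex g" "\<And>f. f \<in> g \<Longrightarrow> f (\<tau> t) - f x < 0"
    using kkm_open[where a = "\<lambda>f t. f (\<tau> t) - f x", OF fin ne card_subproblem_le[OF g ne] cf ex] by blast
  have "\<tau> t = x"
  proof (rule pareto_le_imp_eq[OF g x(1)])
    show "\<tau> t \<in> X" using \<tau>P[OF t(1)] pareto_subset by blast
    show "f (\<tau> t) \<le> f x" if "f \<in> g" for f using t(2)[OF that] by simp
  qed
  then show False using \<tau>x[OF t(1)] by simp
qed

text \<open>If the interiors of the facets omitting \<open>i\<close> and \<open>j\<close> overlapped, the objectives in
  \<open>L = g - {i, j}\<close> would map the overlap \<open>N\<close> onto an open set. But a point of \<open>P g\<close> with the same
  \<open>L\<close>-values as a point of \<open>N\<close> coincides with it, so a whole neighbourhood in \<open>P g\<close> would lie in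
  the boundary.\<close>

lemma facets_no_overlap:
  assumes g: "g \<subseteq> F" and hom: "homeomorphism (P g) (std_simplex g) \<phi> \<psi>"
    and c\<sigma>: "continuous_on (simplex_boundary g) \<sigma>"
    and i\<sigma>: "\<And>h. h \<subset> g \<Longrightarrow> inj_on \<sigma> (std_simplex h)"
    and s\<sigma>: "\<And>h. h \<subset> g \<Longrightarrow> \<sigma> ` std_simplex h = P h"
    and ij: "i \<in> g" "j \<in> g" "i \<noteq> j"
    and t: "t \<in> simplex_interior (g - {i})" "t' \<in> simplex_interior (g - {j})" and eq: "\<phi> (\<sigma> t) = \<phi> (\<sigma> t')"
  shows False
proof -
  have fin: "finite g" using finite_sub[OF g] .
  define \<theta> where "\<theta> = \<phi> \<circ> \<sigma>"
  have \<theta>bd: "\<theta> ` simplex_boundary g \<subseteq> simplex_boundary g"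
    unfolding \<theta>_def using boundary_image_pareto(1)[OF g hom s\<sigma>] by blast
  have \<sigma>P: "\<sigma> t \<in> P g" if "t \<in> simplex_boundary g" for t
    using boundary_image_pareto(2)[OF g hom s\<sigma> that] by blast
  have c\<theta>: "continuous_on (simplex_boundary g) \<theta>"
    unfolding \<theta>_def
    by (intro continuous_on_compose c\<sigma> continuous_on_subset[OF homeomorphism_cont1[OF hom]])
       (use \<sigma>P in blast)
  have \<phi>inj: "inj_on \<phi> (P g)" by (rule inj_on_inverseI[of _ \<psi>]) (rule homeomorphism_apply1[OF hom])
  have \<psi>\<theta>: "\<psi> (\<theta> u) = \<sigma> u" if "u \<in> simplex_boundary g" for u
    using homeomorphism_apply1[OF hom \<sigma>P[OF that]] by (simp add: \<theta>_def)
  let ?gi = "g - {i}" and ?gj = "g - {j}" and ?L = "g - {i} - {j}"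
  have psub: "?gi \<subset> g" "?gj \<subset> g" using ij by auto
  have subF: "?gi \<subseteq> F" "?gj \<subseteq> F" using g by auto
  have fini: "finite ?gi" using fin by simp
  have bdi: "std_simplex ?gi \<subseteq> simplex_boundary g" and bdj: "std_simplex ?gj \<subseteq> simplex_boundary g"
    using std_simplex_proper_face_boundary[OF fin] psub by auto
  have intD: "simplex_interior h \<subseteq> std_simplex h" for h :: "'n objective set" by (auto simp: simplex_interior_def)
  have \<sigma>i: "\<sigma> u \<in> P ?gi" if "u \<in> std_simplex ?gi" for u using s\<sigma>[OF psub(1)] that by blast
  have \<sigma>j: "\<sigma> u \<in> P ?gj" if "u \<in> std_simplex ?gj" for u using s\<sigma>[OF psub(2)] that by blast
  have "inj_on \<theta> (simplex_interior ?gj)"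
    unfolding \<theta>_def
  proof (rule comp_inj_on)
    show "inj_on \<sigma> (simplex_interior ?gj)" by (rule inj_on_subset[OF i\<sigma>[OF psub(2)] intD])
    show "inj_on \<phi> (\<sigma> ` simplex_interior ?gj)"
      by (rule inj_on_subset[OF \<phi>inj]) (use \<sigma>P bdj intD in blast)
  qed
  then have "openin (top_of_set (simplex_boundary g)) (\<theta> ` simplex_interior ?gj)"
    using openin_boundary_star_image[OF fin, of ?gj \<theta>] c\<theta> \<theta>bd ij
    unfolding boundary_facet_star[OF fin ij(2)] by blast
  then have "openin (top_of_set (std_simplex ?gi)) (std_simplex ?gi \<inter> \<theta> -` (\<theta> ` simplex_interior ?gj))"
    by (rule continuous_openin_preimage[OF continuous_on_subset[OF c\<theta> bdi], rotated])
       (use \<theta>bd bdi in blast)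
  \<comment> \<open>The parameters in the open facet omitting \<open>i\<close> whose image is also
    attained on the open facet omitting \<open>j\<close>; their images are Pareto optimal for both
    subproblems.\<close>
  define N where "N = simplex_interior ?gi \<inter> (std_simplex ?gi \<inter> \<theta> -` (\<theta> ` simplex_interior ?gj))"
  have N: "openin (top_of_set (std_simplex ?gi)) N"
    unfolding N_def by (rule openin_Int[OF simplex_interior_openin[OF fini]]) fact
  have NI: "N \<subseteq> simplex_interior ?gi" by (auto simp: N_def)
  have ND: "N \<subseteq> std_simplex ?gi" using NI intD by blast
  have Nj: "\<sigma> u \<in> P ?gj" if u: "u \<in> N" for u
  proof -
    obtain u' where u': "u' \<in> simplex_interior ?gj" "\<theta> u = \<theta> u'" using u by (auto simp: N_def)
    have "u \<in> simplex_boundary g" "u' \<in> simplex_boundary g" using u u' ND bdi bdj intD by blast+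
    then have "\<sigma> u = \<sigma> u'" using \<psi>\<theta> u'(2) by metis
    then show ?thesis using \<sigma>j u'(1) intD by (metis subsetD)
  qed
  have tN: "t \<in> N" using t eq intD by (force simp: N_def \<theta>_def)
  \<comment> \<open>Besides \<open>i\<close> also \<open>j\<close> is dropped: the remaining
    \<open>card g - 2\<close> values match the dimension of the facet, and they are injective
    because two points agreeing on \<open>?L\<close> are comparable through \<open>j\<close>
    alone.\<close>
  define k where "k u = eval_map ?L (\<sigma> u)" for u
  have W: "openin (top_of_set (coord_space ?L)) (k ` N)"
  proof (rule invariance_of_domain_simplex[OF fini _ _ _ N NI])
    show "?gi \<noteq> {}" "finite ?L" "card ?L = card ?gi - 1" using fin ij by auto
    have c\<sigma>N: "continuous_on N \<sigma>" by (rule continuous_on_subset[OF c\<sigma>]) (use ND bdi in blast)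
    show "continuous_on N k"
    proof (rule continuous_on_coordinatewise_then_product)
      fix f show "continuous_on N (\<lambda>u. k u f)"
      proof (cases "f \<in> ?L")
        case True
        then have "f \<in> ?gi" by simp
        then have "continuous_on N (\<lambda>u. f (\<sigma> u))"
          by (rule continuous_on_compose2[OF continuous_objective[OF subF(1)] c\<sigma>N]) (use \<sigma>i ND in blast)
        then show ?thesis using True by (simp add: k_def eval_map_def)
      next
        case False then show ?thesis unfolding k_def eval_map_def by (simp only: if_False continuous_on_const)
      qed
    qed
    show "k ` N \<subseteq> coord_space ?L" by (auto simp: k_def eval_map_def coord_space_def)
    show "inj_on k N"
    proof (rule inj_onI)
      fix u v assume u: "u \<in> N" and v: "v \<in> N" and keq: "k u = k v"
      have L: "f (\<sigma> u) = f (\<sigma> v)" if "f \<in> ?L" for f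
        using fun_cong[OF keq, of f] that by (simp add: k_def eval_map_def)
      have uP: "\<sigma> u \<in> P ?gi" and vP: "\<sigma> v \<in> P ?gi" using u v ND \<sigma>i by auto
      have "\<sigma> u = \<sigma> v"
      proof (cases "j (\<sigma> u) \<le> j (\<sigma> v)")
        case True
        show ?thesis
        proof (rule pareto_le_imp_eq[OF subF(1) vP])
          show "\<sigma> u \<in> X" using uP pareto_subset by blast
          show "f (\<sigma> u) \<le> f (\<sigma> v)" if "f \<in> ?gi" for f
            using L[of f] True that by (cases "f = j") auto
        qed
      next
        case False
        have "\<sigma> v = \<sigma> u"
        proof (rule pareto_le_imp_eq[OF subF(1) uP])
          show "\<sigma> v \<in> X" using vP pareto_subset by blast
          show "f (\<sigma> v) \<le> f (\<sigma> u)" if "f \<in> ?gi" for f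
            using L[of f] False that by (cases "f = j") auto
        qed
        then show ?thesis by simp
      qed
      then show "u = v" using inj_onD[OF i\<sigma>[OF psub(1)]] u v ND by blast
    qed
  qed
  define m where "m s = eval_map ?L (\<psi> s)" for s
  have cm: "continuous_on (std_simplex g) m"
  proof (rule continuous_on_coordinatewise_then_product)
    fix f show "continuous_on (std_simplex g) (\<lambda>s. m s f)"
    proof (cases "f \<in> ?L")
      case True
      then have "f \<in> g" by simp
      then have "continuous_on (std_simplex g) (\<lambda>s. f (\<psi> s))"
        by (rule continuous_on_compose2[OF continuous_objective[OF g] homeomorphism_cont2[OF hom]])
           (use homeomorphism_image2[OF hom] in blast)
      then show ?thesis using True by (simp add: m_def eval_map_def)
    next
      case False then show ?thesis unfolding m_def eval_map_def by (simp only: if_False continuous_on_const)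
    qed
  qed
  \<comment> \<open>The same values define a map on the whole simplex. Its preimage of the open set
    is a neighbourhood of the boundary point \<open>\<theta> t\<close> and therefore contains an
    interior point \<open>s\<close>.\<close>
  have op: "openin (top_of_set (std_simplex g)) (std_simplex g \<inter> m -` (k ` N))"
    by (rule continuous_openin_preimage[OF cm _ W]) (auto simp: m_def eval_map_def coord_space_def)
  have tb: "t \<in> simplex_boundary g" using tN ND bdi by blast
  then have "\<theta> t \<in> std_simplex g" using \<theta>bd by (auto simp: simplex_boundary_def)
  moreover have "m (\<theta> t) = k t" unfolding m_def k_def \<psi>\<theta>[OF tb] ..
  then have "\<theta> t \<in> std_simplex g \<inter> m -` (k ` N)" using tN calculation by auto
  ultimately obtain s where s: "s \<in> simplex_interior g" "s \<in> std_simplex g \<inter> m -` (k ` N)"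
    using simplex_interior_dense[OF fin order_refl op] by blast
  then obtain u where u: "u \<in> N" "m s = k u" by blast
  have sD: "s \<in> std_simplex g" using s by blast
  have q: "\<psi> s \<in> P g" using sD homeomorphism_image2[OF hom] by blast
  have L: "f (\<psi> s) = f (\<sigma> u)" if "f \<in> ?L" for f
    using fun_cong[OF u(2), of f] that by (simp add: k_def m_def eval_map_def)
  have ui: "\<sigma> u \<in> P ?gi" using u(1) ND \<sigma>i by blast
  have uX: "\<sigma> u \<in> X" and qX: "\<psi> s \<in> X" using ui q pareto_subset by auto
  \<comment> \<open>With equal values on \<open>?L\<close>, the three cases use optimality of
    \<open>\<sigma> u\<close> for \<open>?gi\<close>, its optimality for \<open>?gj\<close>, and
    that of \<open>\<psi> s\<close> for \<open>g\<close>.\<close>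
  consider "j (\<psi> s) \<le> j (\<sigma> u)" | "i (\<psi> s) \<le> i (\<sigma> u)" | "j (\<sigma> u) \<le> j (\<psi> s)" "i (\<sigma> u) \<le> i (\<psi> s)" by linarith
  then have "\<psi> s = \<sigma> u"
  proof cases
    case 1
    show ?thesis
    proof (rule pareto_le_imp_eq[OF subF(1) ui qX])
      show "f (\<psi> s) \<le> f (\<sigma> u)" if "f \<in> ?gi" for f using L[of f] 1 that by (cases "f = j") auto
    qed
  next
    case 2
    show ?thesis
    proof (rule pareto_le_imp_eq[OF subF(2) Nj[OF u(1)] qX])
      show "f (\<psi> s) \<le> f (\<sigma> u)" if "f \<in> ?gj" for f using L[of f] 2 that by (cases "f = i") auto
    qed
  next
    case 3
    have "\<sigma> u = \<psi> s"
    proof (rule pareto_le_imp_eq[OF g q uX])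
      show "f (\<sigma> u) \<le> f (\<psi> s)" if "f \<in> g" for f
        using L[of f] 3 that by (cases "f = i"; cases "f = j") auto
    qed
    then show ?thesis by simp
  qed
  then have "\<theta> u = s" using homeomorphism_apply2[OF hom sD] by (simp add: \<theta>_def)
  moreover have "\<theta> u \<in> simplex_boundary g" using \<theta>bd u(1) ND bdi by blast
  ultimately show False using s(1) by (simp add: simplex_boundary_def)
qed

text \<open>Once the boundary parametrisation is injective, a point common to two proper faces has a
  single parameter, which lies in the intersection of the two simplexes. A failure of injectivity
  would produce an overlap of two open facets.\<close>

lemma faces_meet_step:
  assumes g: "g \<subseteq> F" and hom: "homeomorphism (P g) (std_simplex g) \<phi> \<psi>"
    and c\<sigma>: "continuous_on (simplex_boundary g) \<sigma>"
    and i\<sigma>: "\<And>h. h \<subset> g \<Longrightarrow> inj_on \<sigma> (std_simplex h)"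
    and s\<sigma>: "\<And>h. h \<subset> g \<Longrightarrow> \<sigma> ` std_simplex h = P h"
  shows "faces_meet g"
  unfolding faces_meet_def
proof (intro allI impI)
  have fin: "finite g" using finite_sub[OF g] .
  have \<theta>bd: "(\<phi> \<circ> \<sigma>) ` simplex_boundary g \<subseteq> simplex_boundary g"
    using boundary_image_pareto(1)[OF g hom s\<sigma>] by blast
  have \<sigma>P: "\<sigma> t \<in> P g" if "t \<in> simplex_boundary g" for t
    using boundary_image_pareto(2)[OF g hom s\<sigma> that] by blast
  have c\<theta>: "continuous_on (simplex_boundary g) (\<phi> \<circ> \<sigma>)"
    by (intro continuous_on_compose c\<sigma> continuous_on_subset[OF homeomorphism_cont1[OF hom]])
       (use \<sigma>P in blast)
  have \<phi>inj: "inj_on \<phi> (P g)" by (rule inj_on_inverseI[of _ \<psi>]) (rule homeomorphism_apply1[OF hom])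
  have facet: "inj_on (\<phi> \<circ> \<sigma>) (std_simplex (g - {i}))" if "i \<in> g" for i
  proof (rule comp_inj_on)
    have psub: "g - {i} \<subset> g" using that by blast
    show "inj_on \<sigma> (std_simplex (g - {i}))" by (rule i\<sigma>[OF psub])
    show "inj_on \<phi> (\<sigma> ` std_simplex (g - {i}))"
      by (rule inj_on_subset[OF \<phi>inj]) (use \<sigma>P std_simplex_proper_face_boundary[OF fin psub] in blast)
  qed
  have inj: "inj_on (\<phi> \<circ> \<sigma>) (simplex_boundary g)"
  proof (rule ccontr)
    assume "\<not> inj_on (\<phi> \<circ> \<sigma>) (simplex_boundary g)"
    then obtain i j t t' where "i \<in> g" "j \<in> g" "i \<noteq> j" "t \<in> simplex_interior (g - {i})"
      "t' \<in> simplex_interior (g - {j})" "(\<phi> \<circ> \<sigma>) t = (\<phi> \<circ> \<sigma>) t'"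
      using boundary_map_facet_overlap[OF fin c\<theta> \<theta>bd facet] by blast
    then show False using facets_no_overlap[OF g hom c\<sigma> i\<sigma> s\<sigma>] by simp
  qed
  fix h1 h2 assume h: "h1 \<subseteq> g" "h2 \<subseteq> g"
  show "P h1 \<inter> P h2 \<subseteq> P (h1 \<inter> h2)"
  proof (cases "h1 = g \<or> h2 = g")
    case True then show ?thesis using h by (auto simp: inf.absorb1 inf.absorb2)
  next
    case False
    then have psub: "h1 \<subset> g" "h2 \<subset> g" "h1 \<inter> h2 \<subset> g" using h by auto
    show ?thesis
    proof clarify
      fix x assume x: "x \<in> P h1" "x \<in> P h2"
      obtain t1 where t1: "t1 \<in> std_simplex h1" "x = \<sigma> t1" using x(1) s\<sigma>[OF psub(1)] by blast
      obtain t2 where t2: "t2 \<in> std_simplex h2" "x = \<sigma> t2" using x(2) s\<sigma>[OF psub(2)] by blast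
      have "t1 \<in> simplex_boundary g" "t2 \<in> simplex_boundary g"
        using std_simplex_proper_face_boundary[OF fin] psub t1 t2 by auto
      then have "t1 = t2" using inj_onD[OF inj, of t1 t2] t1 t2 by simp
      then have "t1 \<in> std_simplex (h1 \<inter> h2)"
        using t1 t2 std_simplex_Int[of h1 h2] fin h finite_subset by blast
      then show "x \<in> P (h1 \<inter> h2)" using s\<sigma>[OF psub(3)] t1(2) by blast
    qed
  qed
qed

lemma faces_cover_and_meet:
  assumes "g \<subseteq> F"
  shows "faces_cover g \<and> faces_meet g"
  using finite_sub[OF assms] assms
proof (induction g rule: finite_psubset_induct)
  case (psubset g)
  note g = psubset.prems
  have IH: "faces_cover h \<and> faces_meet h" if "h \<subset> g" for h
    using psubset.IH[OF that] that g by blast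
  obtain \<sigma> where \<sigma>: "continuous_on (simplex_boundary g) \<sigma>"
    "\<And>h. h \<subset> g \<Longrightarrow> inj_on \<sigma> (std_simplex h)" "\<And>h. h \<subset> g \<Longrightarrow> \<sigma> ` std_simplex h = P h"
    using parametrize_faces[OF g IH] by blast
  obtain \<phi> \<psi> where hom: "homeomorphism (P g) (std_simplex g) \<phi> \<psi>"
    using pareto_homeomorphism[OF g] .
  show ?case using faces_cover_step[OF g hom \<sigma>(1,3)] faces_meet_step[OF g hom \<sigma>] by blast
qed

section \<open>From the face structure to the stratification\<close>

lemma interior_subset: "I g \<subseteq> P g"
  by (auto simp: mfd_interior_def)

text \<open>A point outside the manifold interior lies in a proper face; the descent through smaller
  faces ends at one that has the point in its interior.\<close>

lemma pareto_in_some_interior: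
  assumes "g \<subseteq> F" "x \<in> P g"
  shows "\<exists>h. h \<subseteq> g \<and> x \<in> I h"
  using finite_sub[OF assms(1)] assms
proof (induction g rule: finite_psubset_induct)
  case (psubset g)
  show ?case
  proof (cases "x \<in> I g")
    case False
    then obtain h where h: "h \<subset> g" "x \<in> P h"
      using faces_cover_and_meet[OF psubset.prems(1)] psubset.prems(2) unfolding faces_cover_def by blast
    then have "\<exists>h'. h' \<subseteq> h \<and> x \<in> I h'" using psubset.IH[OF h(1)] psubset.prems(1) by blast
    then show ?thesis using h by blast
  qed blast
qed

lemma boundary_eq_interiors:
  assumes g: "g \<subseteq> F"
  shows "mfd_boundary (card g - 1) (P g) = (\<Union>h\<in>{h. h \<subset> g}. I h)"
proof
  show "mfd_boundary (card g - 1) (P g) \<subseteq> (\<Union>h\<in>{h. h \<subset> g}. I h)"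
  proof
    fix x assume "x \<in> mfd_boundary (card g - 1) (P g)"
    then have x: "x \<in> P g" "x \<notin> I g" by (auto simp: mfd_boundary_def)
    obtain h where h: "h \<subseteq> g" "x \<in> I h" using pareto_in_some_interior[OF g x(1)] by blast
    then have "h \<subset> g" using x(2) by blast
    then show "x \<in> (\<Union>h\<in>{h. h \<subset> g}. I h)" using h by blast
  qed
  show "(\<Union>h\<in>{h. h \<subset> g}. I h) \<subseteq> mfd_boundary (card g - 1) (P g)"
  proof
    fix x assume "x \<in> (\<Union>h\<in>{h. h \<subset> g}. I h)"
    then obtain h where h: "h \<subset> g" and x: "x \<in> I h" by blast
    have xh: "x \<in> P h" using x interior_subset by blast
    then have "x \<in> P g" using pareto_mono[OF g, of h] h by blast
    then show "x \<in> mfd_boundary (card g - 1) (P g)"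
      using subproblem_not_interior[OF g h xh] by (simp add: mfd_boundary_def)
  qed
qed

text \<open>A common point lies in the Pareto set of \<open>h1 \<inter> h2\<close>, a proper
  subproblem of at least one of the two, and such sets avoid the interior.\<close>

lemma interiors_disjoint:
  assumes "h1 \<subseteq> F" "h2 \<subseteq> F" "h1 \<noteq> h2"
  shows "I h1 \<inter> I h2 = {}"
proof (rule ccontr)
  assume "I h1 \<inter> I h2 \<noteq> {}"
  then obtain x where x: "x \<in> I h1" "x \<in> I h2" by blast
  then have "x \<in> P (h1 \<inter> h2)"
    using faces_cover_and_meet[OF order_refl] assms interior_subset unfolding faces_meet_def by blast
  moreover have "h1 \<inter> h2 \<subset> h1 \<or> h1 \<inter> h2 \<subset> h2" using assms(3) by blast
  ultimately show False using subproblem_not_interior assms x by blast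
qed

lemma disjoint_interiors:
  assumes "g \<subseteq> F"
  shows "disjoint_family_on I {h. h \<subset> g}"
  unfolding disjoint_family_on_def using interiors_disjoint assms by (metis mem_Collect_eq order_trans psubset_imp_subset)

text \<open>All Pareto sets of subproblems lie in that of \<open>F\<close>, on which
  \<open>eval_map F\<close> is an embedding by (S2). One homeomorphism thus carries interiors,
  differences and intersections to the images.\<close>

lemma
  assumes g: "g \<subseteq> F"
  shows image_boundary_eq_interiors: "mfd_boundary (card g - 1) (eval_map F ` P g)
           = (\<Union>h\<in>{h. h \<subset> g}. mfd_interior (card h - 1) (eval_map F ` P h))"
    and disjoint_image_interiors:
      "disjoint_family_on (\<lambda>h. mfd_interior (card h - 1) (eval_map F ` P h)) {h. h \<subset> g}"
proof -
  obtain e where e: "homeomorphism (P F) (eval_map F ` P F) (eval_map F) e"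
    using eval_map_homeomorphism[OF order_refl] .
  have inj: "inj_on (eval_map F) (P F)" by (rule inj_on_inverseI[of _ e]) (rule homeomorphism_apply1[OF e])
  have PF: "P h \<subseteq> P F" if "h \<subseteq> F" for h using pareto_mono[OF order_refl that] .
  have int: "mfd_interior d (eval_map F ` P h) = eval_map F ` mfd_interior d (P h)" if "h \<subseteq> F" for d h
  proof (rule mfd_interior_homeomorphism)
    show "homeomorphism (P h) (eval_map F ` P h) (eval_map F) e"
      by (rule homeomorphism_of_subsets[OF e PF[OF that] image_mono[OF PF[OF that]] refl])
  qed
  have IF: "I h \<subseteq> P F" if "h \<subseteq> F" for h using interior_subset[of h] PF[OF that] by blast
  have sub: "h \<subseteq> F" if "h \<subset> g" for h using that g by blast
  have "mfd_boundary (card g - 1) (eval_map F ` P g) = eval_map F ` mfd_boundary (card g - 1) (P g)"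
    unfolding mfd_boundary_def int[OF g] using inj_on_image_set_diff[OF inj, of "P g" "I g"] PF[OF g] IF[OF g] by blast
  also have "\<dots> = (\<Union>h\<in>{h. h \<subset> g}. eval_map F ` I h)"
    unfolding boundary_eq_interiors[OF g] by blast
  also have "\<dots> = (\<Union>h\<in>{h. h \<subset> g}. mfd_interior (card h - 1) (eval_map F ` P h))"
    using int sub by auto
  finally show "mfd_boundary (card g - 1) (eval_map F ` P g)
           = (\<Union>h\<in>{h. h \<subset> g}. mfd_interior (card h - 1) (eval_map F ` P h))" .
  show "disjoint_family_on (\<lambda>h. mfd_interior (card h - 1) (eval_map F ` P h)) {h. h \<subset> g}"
    unfolding disjoint_family_on_def
  proof (intro ballI impI)
    fix h1 h2 assume h: "h1 \<in> {h. h \<subset> g}" "h2 \<in> {h. h \<subset> g}" "h1 \<noteq> h2"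
    have F: "h1 \<subseteq> F" "h2 \<subseteq> F" using h sub by auto
    have "eval_map F ` I h1 \<inter> eval_map F ` I h2 = eval_map F ` (I h1 \<inter> I h2)"
      by (rule inj_on_image_Int[OF inj IF[OF F(1)] IF[OF F(2)], symmetric])
    then show "mfd_interior (card h1 - 1) (eval_map F ` P h1) \<inter> mfd_interior (card h2 - 1) (eval_map F ` P h2) = {}"
      using interiors_disjoint[OF F h(3)] int F by simp
  qed
qed

end

theorem theorem1:
  fixes F :: "'n::finite objective set" and X :: "(real^'n) set" and g :: "'n objective set"
  assumes "simple_problem F X" and "g \<subseteq> F"
  shows "mfd_boundary (card g - 1) (pareto_set X g)
           = (\<Union>h\<in>{h. h \<subset> g}. mfd_interior (card h - 1) (pareto_set X h))
       \<and> disjoint_family_on (\<lambda>h. mfd_interior (card h - 1) (pareto_set X h)) {h. h \<subset> g}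
       \<and> mfd_boundary (card g - 1) (eval_map F ` pareto_set X g)
           = (\<Union>h\<in>{h. h \<subset> g}. mfd_interior (card h - 1) (eval_map F ` pareto_set X h))
       \<and> disjoint_family_on (\<lambda>h. mfd_interior (card h - 1) (eval_map F ` pareto_set X h)) {h. h \<subset> g}"
proof -
  interpret simple_multiobjective_problem F X using assms(1) by unfold_locales
  show ?thesis
    using boundary_eq_interiors[OF assms(2)] disjoint_interiors[OF assms(2)]
      image_boundary_eq_interiors[OF assms(2)] disjoint_image_interiors[OF assms(2)] by blast
qed

end
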